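(* Let $Q>0$, let $Z=(Z,d,\mu)$ be an Ahlfors $Q$-regular compact metric measure space with $\operatorname{diam}(Z)=1$, let $X=(V,E)$ be a hyperbolic filling of $Z$, and let $p>1$. Then the map $f\in A^p(Z)\mapsto \|f\|_{A^p}=\|d(Pf)\|_{\ell^{p,\infty}}$ defines a norm on $A^p(Z)$. With this norm, $A^p(Z)$ is a Banach space that is isomorphic to a closed subspace of $\ell^{p,\infty}(E)$.
   Context: Ahlfors regularity: a metric space $(Z,d)$ with a Borel measure $\mu$ is Ahlfors $Q$-regular (with $\operatorname{diam}(Z)=1$) if there is a constant $c\ge 1$ with $c^{-1}r^Q\le\mu(B)\le c\,r^Q$ for every open ball $B$ of radius $0<r\le 1$. Write $|A|=\mu(A)$. Hyperbolic filling: for each $n\in\mathbb{N}=\{1,2,\dots\}$ choose a maximal $2^{-n}$-separated set $Z_n\subset Z$. Let $V_n$ be the collection of balls $B(z,2^{1-n})$, $z\in Z_n$ (level $n$), and $V_0=\{Z\}$ (level $0$). The vertex set $V$ is the disjoint union of the $V_n$, $n\ge 0$. Two distinct vertices $B,B'$ are joined by an (unoriented, unique) edge if their levels differ by at most $1$ and $B\cap B'\ne\emptyset$; $E$ is the set of edges. For each edge $e$ one fixes a choice of initial vertex $e_-$ and terminal vertex $e_+$ among its two endpoints. Poisson extension: for $f\in L^1(Z)$ (real-valued), $Pf\colon V\to\mathbb{R}$ is $Pf(B)=\frac1{|B|}\int_B f\,d\mu$. Gradient: for $u\colon V\to\mathbb{R}$, $du\colon E\to\mathbb{R}$ is $du(e)=u(e_+)-u(e_-)$.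 Weak $\ell^p$: for a countable set $M$ and $p>1$, $\ell^{p,\infty}(M)$ is the space of all $s\colon M\to\mathbb{R}$ for which there is $C\ge0$ with $\#\{m\in M:|s(m)|>\lambda\}\le (C/\lambda)^p$ for all $\lambda>0$, with norm $\|s\|_{\ell^{p,\infty}}=\sup\{n^{-1+1/p}\sum_{j\in F}|s(j)|: n\in\mathbb{N},\ F\subset M,\ \#F=n\}$ (finite exactly on $\ell^{p,\infty}(M)$). $\dot A^p(Z)$ is the space of all $f\in L^1(Z)$ with $d(Pf)\in\ell^{p,\infty}(E)$, and $A^p(Z)=\dot A^p(Z)/\mathbb{R}$ is its quotient by the (almost everywhere) constant functions. "Isomorphic" means linearly isomorphic via a bounded map with bounded inverse. *)

theory Defs
  imports "HOL-Analysis.Analysis" "HOL-Algebra.Module" "HOL-Algebra.AbelCoset"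
begin

section \<open>Real normed spaces with explicit carrier\<close>

text \<open>
  The spaces below depend on a measure, an exponent and a graph, so they cannot be instances of
  the type classes for normed spaces. A real vector space is a module over \<open>real_ring\<close>;
  the multiplicative fields \<open>mult\<close> and \<open>one\<close> of the module record play no role.
\<close>

definition real_ring :: "real ring" where
  "real_ring = \<lparr>carrier = UNIV, mult = (*), one = 1, zero = 0, add = (+)\<rparr>"

locale normed_module = module real_ring X for X :: "(real, 'a, 'b) module_scheme" (structure) +
  fixes nrm :: "'a \<Rightarrow> real"
  assumes nrm_nonneg: "x \<in> carrier X \<Longrightarrow> 0 \<le> nrm x"
    and nrm_eq_0_iff: "x \<in> carrier X \<Longrightarrow> nrm x = 0 \<longleftrightarrow> x = \<zero>\<^bsub>X\<^esub>"
    and nrm_smult: "x \<in> carrier X \<Longrightarrow> nrm (a \<odot>\<^bsub>X\<^esub> x) = \<bar>a\<bar> * nrm x"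
    and nrm_triangle: "\<lbrakk>x \<in> carrier X; y \<in> carrier X\<rbrakk> \<Longrightarrow> nrm (x \<oplus>\<^bsub>X\<^esub> y) \<le> nrm x + nrm y"

text \<open>
  The value 0 off the carrier is irrelevant; it only serves the locale \<open>Metric_space\<close>, whose
  distances are symmetric and nonnegative on the whole type.
\<close>

definition norm_dist ::
    "(real, 'a, 'b) module_scheme \<Rightarrow> ('a \<Rightarrow> real) \<Rightarrow> 'a \<Rightarrow> 'a \<Rightarrow> real" where
  "norm_dist X nrm x y =
     (if x \<in> carrier X \<and> y \<in> carrier X then nrm (x \<ominus>\<^bsub>X\<^esub> y) else 0)"

lemma (in normed_module) nrm_minus:
  assumes "x \<in> carrier X" shows "nrm (\<ominus>\<^bsub>X\<^esub> x) = nrm x"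
proof -
  have one: "\<one>\<^bsub>real_ring\<^esub> = 1" "1 \<in> carrier real_ring"
    by (auto simp: real_ring_def)
  have "(-1) \<oplus>\<^bsub>real_ring\<^esub> 1 = \<zero>\<^bsub>real_ring\<^esub>"
    by (simp add: real_ring_def)
  then have "\<ominus>\<^bsub>real_ring\<^esub> 1 = -1"
    using R.minus_equality[of "-1" 1] by (simp add: real_ring_def)
  then have "(-1) \<odot>\<^bsub>X\<^esub> x = \<ominus>\<^bsub>X\<^esub> x"
    using smult_l_minus[OF one(2) assms] smult_one[OF assms] one(1) by simp
  then show ?thesis
    using nrm_smult[OF assms, of "-1"] by simp
qed

sublocale normed_module \<subseteq> Metric_space "carrier X" "norm_dist X nrm"
proof
  fix x y
  show "0 \<le> norm_dist X nrm x y"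
    by (auto simp: norm_dist_def intro: nrm_nonneg)
  have "nrm (x \<ominus>\<^bsub>X\<^esub> y) = nrm (y \<ominus>\<^bsub>X\<^esub> x)"
    if "x \<in> carrier X" "y \<in> carrier X"
  proof -
    have "\<ominus>\<^bsub>X\<^esub> (x \<ominus>\<^bsub>X\<^esub> y) = y \<ominus>\<^bsub>X\<^esub> x"
      using that by (simp add: M.minus_eq M.minus_add M.a_comm)
    then show ?thesis
      using nrm_minus[of "x \<ominus>\<^bsub>X\<^esub> y"] that by simp
  qed
  then show "norm_dist X nrm x y = norm_dist X nrm y x"
    by (auto simp: norm_dist_def)
next
  fix x y assume xy: "x \<in> carrier X" "y \<in> carrier X"
  then have "x = (x \<ominus>\<^bsub>X\<^esub> y) \<oplus>\<^bsub>X\<^esub> y"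
    by (simp add: M.minus_eq M.a_assoc M.l_neg)
  then have "x \<ominus>\<^bsub>X\<^esub> y = \<zero>\<^bsub>X\<^esub> \<longleftrightarrow> x = y"
    using xy by (metis M.l_zero M.minus_eq M.r_neg)
  then show "norm_dist X nrm x y = 0 \<longleftrightarrow> x = y"
    using xy by (simp add: norm_dist_def nrm_eq_0_iff)
next
  fix x y z assume xyz: "x \<in> carrier X" "y \<in> carrier X" "z \<in> carrier X"
  then have "x \<ominus>\<^bsub>X\<^esub> z = (x \<ominus>\<^bsub>X\<^esub> y) \<oplus>\<^bsub>X\<^esub> (y \<ominus>\<^bsub>X\<^esub> z)"
    by (simp add: M.minus_eq M.a_assoc M.r_neg1)
  then show "norm_dist X nrm x z \<le> norm_dist X nrm x y + norm_dist X nrm y z"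
    using nrm_triangle[of "x \<ominus>\<^bsub>X\<^esub> y" "y \<ominus>\<^bsub>X\<^esub> z"] xyz by (simp add: norm_dist_def)
qed

locale banach_module = normed_module +
  assumes complete: mcomplete

definition closed_subspace ::
    "'a set \<Rightarrow> (real, 'a, 'b) module_scheme \<Rightarrow> ('a \<Rightarrow> real) \<Rightarrow> bool" where
  "closed_subspace W X nrm \<longleftrightarrow>
     submodule W real_ring X \<and> closedin (Metric_space.mtopology (carrier X) (norm_dist X nrm)) W"

definition bounded_linear_map ::
    "(real, 'a, 'c) module_scheme \<Rightarrow> ('a \<Rightarrow> real) \<Rightarrow>
     (real, 'b, 'd) module_scheme \<Rightarrow> ('b \<Rightarrow> real) \<Rightarrow> ('a \<Rightarrow> 'b) \<Rightarrow> bool" where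
  "bounded_linear_map X nX Y nY T \<longleftrightarrow>
     T \<in> carrier X \<rightarrow> carrier Y \<and>
     (\<forall>x\<in>carrier X. \<forall>y\<in>carrier X. T (x \<oplus>\<^bsub>X\<^esub> y) = T x \<oplus>\<^bsub>Y\<^esub> T y) \<and>
     (\<forall>a. \<forall>x\<in>carrier X. T (a \<odot>\<^bsub>X\<^esub> x) = a \<odot>\<^bsub>Y\<^esub> T x) \<and>
     (\<exists>K. \<forall>x\<in>carrier X. nY (T x) \<le> K * nX x)"

definition normed_isomorphic ::
    "(real, 'a, 'c) module_scheme \<Rightarrow> ('a \<Rightarrow> real) \<Rightarrow>
     (real, 'b, 'd) module_scheme \<Rightarrow> ('b \<Rightarrow> real) \<Rightarrow> bool" where
  "normed_isomorphic X nX Y nY \<longleftrightarrow>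
     (\<exists>T. bij_betw T (carrier X) (carrier Y) \<and>
          bounded_linear_map X nX Y nY T \<and>
          bounded_linear_map Y nY X nX (inv_into (carrier X) T))"

text \<open>Quotient of a vector space by a subspace: the additive cosets of \<open>N\<close>.\<close>

definition quotient_module ::
    "(real, 'a, 'b) module_scheme \<Rightarrow> 'a set \<Rightarrow> (real, 'a set) module" where
  "quotient_module X N =
     \<lparr>carrier = a_rcosets\<^bsub>X\<^esub> N, mult = undefined, one = undefined,
      zero = N, add = set_add X,
      smult = (\<lambda>a S. \<Union>x\<in>S. N +>\<^bsub>X\<^esub> (a \<odot>\<^bsub>X\<^esub> x))\<rparr>"

text \<open>A set of real functions with the pointwise operations.\<close>

definition function_module :: "('m \<Rightarrow> real) set \<Rightarrow> (real, 'm \<Rightarrow> real) module" where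
  "function_module S =
     \<lparr>carrier = S, mult = undefined, one = undefined,
      zero = (\<lambda>_. 0), add = (\<lambda>f g x. f x + g x), smult = (\<lambda>a f x. a * f x)\<rparr>"

section \<open>Weak \<open>\<ell>\<^sup>p\<close>\<close>

text \<open>
  Functions on \<open>M\<close> are represented by functions on the whole type that vanish outside \<open>M\<close>.
\<close>

definition weak_lp_set :: "real \<Rightarrow> 'm set \<Rightarrow> ('m \<Rightarrow> real) set" where
  "weak_lp_set p M =
     {s. (\<forall>m. m \<notin> M \<longrightarrow> s m = 0) \<and>
         (\<exists>C\<ge>0. \<forall>t>0. finite {m\<in>M. \<bar>s m\<bar> > t} \<and>
                      real (card {m\<in>M. \<bar>s m\<bar> > t}) \<le> (C / t) powr p)}"

definition weak_lp :: "real \<Rightarrow> 'm set \<Rightarrow> (real, 'm \<Rightarrow> real) module" where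
  "weak_lp p M = function_module (weak_lp_set p M)"

text \<open>
  The real supremum is meaningful for \<open>s\<close> in \<^term>\<open>weak_lp_set p M\<close> with \<open>p > 1\<close>
  and \<open>M\<close> nonempty.
\<close>

definition weak_lp_norm :: "real \<Rightarrow> 'm set \<Rightarrow> ('m \<Rightarrow> real) \<Rightarrow> real" where
  "weak_lp_norm p M s =
     Sup {real n powr (- 1 + 1 / p) * (\<Sum>j\<in>F. \<bar>s j\<bar>) | n F.
            n \<ge> 1 \<and> F \<subseteq> M \<and> finite F \<and> card F = n}"

section \<open>Ahlfors regularity and hyperbolic fillings\<close>

text \<open>The metric space \<open>Z\<close> is the whole type, of class \<open>metric_space\<close>.\<close>

definition ahlfors_regular :: "real \<Rightarrow> 'z::metric_space measure \<Rightarrow> bool" where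
  "ahlfors_regular Q \<mu> \<longleftrightarrow>
     sets \<mu> = sets borel \<and>
     (\<exists>c\<ge>1. \<forall>z r. 0 < r \<and> r \<le> 1 \<longrightarrow>
        ennreal (r powr Q / c) \<le> emeasure \<mu> (ball z r) \<and>
        emeasure \<mu> (ball z r) \<le> ennreal (c * r powr Q))"

definition separated_set :: "real \<Rightarrow> 'z::metric_space set \<Rightarrow> bool" where
  "separated_set \<epsilon> S \<longleftrightarrow> (\<forall>x\<in>S. \<forall>y\<in>S. x \<noteq> y \<longrightarrow> \<epsilon> \<le> dist x y)"

definition maximal_separated_set :: "real \<Rightarrow> 'z::metric_space set \<Rightarrow> bool" where
  "maximal_separated_set \<epsilon> S \<longleftrightarrow>
     separated_set \<epsilon> S \<and> (\<forall>T. separated_set \<epsilon> T \<and> S \<subseteq> T \<longrightarrow> T = S)"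

text \<open>
  A vertex is a pair (level, ball), the ball being a set of points; the level makes the union of
  the \<open>V\<^sub>n\<close> disjoint. An unoriented edge is the set of its two endpoints. The sets of
  centres are given by \<open>Zs\<close>, whose value at level 0 is not used.
\<close>

type_synonym 'z vertex = "nat \<times> 'z set"
type_synonym 'z edge = "'z vertex set"

definition level_balls :: "(nat \<Rightarrow> 'z::metric_space set) \<Rightarrow> nat \<Rightarrow> 'z set set" where
  "level_balls Zs n =
     (if n = 0 then {UNIV} else (\<lambda>z. ball z (2 powr (1 - real n))) ` Zs n)"

definition vertices :: "(nat \<Rightarrow> 'z::metric_space set) \<Rightarrow> 'z vertex set" where
  "vertices Zs = (SIGMA n:UNIV. level_balls Zs n)"

definition edges :: "(nat \<Rightarrow> 'z::metric_space set) \<Rightarrow> 'z edge set" where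
  "edges Zs =
     {{v, w} | v w. v \<in> vertices Zs \<and> w \<in> vertices Zs \<and> v \<noteq> w \<and>
        \<bar>int (fst v) - int (fst w)\<bar> \<le> 1 \<and> snd v \<inter> snd w \<noteq> {}}"

text \<open>\<open>ini e\<close> and \<open>ter e\<close> are the chosen initial and terminal vertices of \<open>e\<close>.\<close>

definition hyperbolic_filling ::
    "(nat \<Rightarrow> 'z::metric_space set) \<Rightarrow> ('z edge \<Rightarrow> 'z vertex) \<Rightarrow> ('z edge \<Rightarrow> 'z vertex) \<Rightarrow> bool" where
  "hyperbolic_filling Zs ini ter \<longleftrightarrow>
     (\<forall>n\<ge>1. maximal_separated_set (2 powr (- real n)) (Zs n)) \<and>
     (\<forall>e\<in>edges Zs. e = {ini e, ter e})"

section \<open>The space \<open>A\<^sup>p\<close>\<close>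

definition poisson :: "'z measure \<Rightarrow> ('z \<Rightarrow> real) \<Rightarrow> 'z vertex \<Rightarrow> real" where
  "poisson \<mu> f v = (LINT x:snd v|\<mu>. f x) / measure \<mu> (snd v)"

definition gradient ::
    "'z edge set \<Rightarrow> ('z edge \<Rightarrow> 'z vertex) \<Rightarrow> ('z edge \<Rightarrow> 'z vertex) \<Rightarrow>
     ('z vertex \<Rightarrow> real) \<Rightarrow> 'z edge \<Rightarrow> real" where
  "gradient E ini ter u e = (if e \<in> E then u (ter e) - u (ini e) else 0)"

definition A_dot ::
    "'z measure \<Rightarrow> real \<Rightarrow> 'z edge set \<Rightarrow> ('z edge \<Rightarrow> 'z vertex) \<Rightarrow> ('z edge \<Rightarrow> 'z vertex) \<Rightarrow>
     (real, 'z \<Rightarrow> real) module" where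
  "A_dot \<mu> p E ini ter =
     function_module {f. integrable \<mu> f \<and> gradient E ini ter (poisson \<mu> f) \<in> weak_lp_set p E}"

text \<open>
  The elements of \<open>A_dot\<close> are integrable functions, not yet identified when they agree almost
  everywhere. Both this identification and the quotient by the constants are achieved by passing
  to cosets of the space of almost everywhere constant functions.
\<close>

definition A_space ::
    "'z measure \<Rightarrow> real \<Rightarrow> 'z edge set \<Rightarrow> ('z edge \<Rightarrow> 'z vertex) \<Rightarrow> ('z edge \<Rightarrow> 'z vertex) \<Rightarrow>
     (real, ('z \<Rightarrow> real) set) module" where
  "A_space \<mu> p E ini ter =
     quotient_module (A_dot \<mu> p E ini ter)
       {f \<in> carrier (A_dot \<mu> p E ini ter). \<exists>c. AE x in \<mu>. f x = c}"

definition A_norm ::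
    "'z measure \<Rightarrow> real \<Rightarrow> 'z edge set \<Rightarrow> ('z edge \<Rightarrow> 'z vertex) \<Rightarrow> ('z edge \<Rightarrow> 'z vertex) \<Rightarrow>
     ('z \<Rightarrow> real) set \<Rightarrow> real" where
  "A_norm \<mu> p E ini ter S =
     weak_lp_norm p E (gradient E ini ter (poisson \<mu> (SOME f. f \<in> S)))"

end

theory Submission
  imports Defs
begin

text \<open>
  The map \<open>f \<mapsto> d(Pf)\<close> is linear from \<open>A_dot\<close> to weak \<open>\<ell>\<^sup>p\<close>. If its kernel consists of the almost everywhere
  constant functions, then the quotient \<open>A\<^sup>p\<close> with the norm of the statement is isometric to the
  image, and it is a Banach space if weak \<open>\<ell>\<^sup>p\<close> is complete (\<open>banach_module_weak_lp\<close>) and the image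
  is closed. This reduction is \<open>isometric_quotient_by_kernel\<close>.

  The kernel and the closedness of the image are both controlled by one inequality of Poincare
  type (\<open>poincare_inequality\<close>): the \<open>L\<^sup>1\<close> distance of \<open>f\<close> from its mean value is at most a constant times
  the weak \<open>\<ell>\<^sup>p\<close> norm of \<open>d(Pf)\<close>. For its proof let \<open>f\<^sub>n(x)\<close> be the mean of the values \<open>Pf(B)\<close> over the
  balls \<open>B\<close> of level \<open>n\<close> that contain \<open>x\<close>. Then \<open>f\<^sub>0\<close> is the mean value of \<open>f\<close>, and \<open>f\<^sub>n\<close> tends to \<open>f\<close>
  in \<open>L\<^sup>1\<close>: this is clear for Lipschitz functions, which are dense, and the maps \<open>f \<mapsto> f\<^sub>n\<close> are
  uniformly bounded because the balls of a level have bounded overlap. The \<open>L\<^sup>1\<close> distance of \<open>f\<^sub>n\<close>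
  and \<open>f\<^sub>n\<^sub>+\<^sub>1\<close> is at most the sum of \<open>\<bar>B\<bar> \<bar>d(Pf)(e)\<bar>\<close> over the edges \<open>e\<close> between the two levels, with
  \<open>B\<close> the endpoint of \<open>e\<close> of level \<open>n + 1\<close>. By Ahlfors regularity there are at most about
  \<open>2 powr (n Q)\<close> such edges, and each ball has measure at most about \<open>2 powr (- n Q)\<close>. The weak \<open>\<ell>\<^sup>p\<close>
  norm bounds a sum over \<open>N\<close> edges by \<open>N powr (1 - 1/p)\<close> times itself, so the distance is at most
  about \<open>2 powr (- n Q / p)\<close> times the norm, and these numbers form a convergent series.

  If \<open>d(Pf) = 0\<close>, the inequality says that \<open>f\<close> is almost everywhere constant. If \<open>d(Pf\<^sub>k)\<close> converges in
  weak \<open>\<ell>\<^sup>p\<close>, it says that the \<open>f\<^sub>k\<close>, normalised to mean value zero, form a Cauchy sequence in \<open>L\<^sup>1\<close>;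
  the averages over balls pass to the \<open>L\<^sup>1\<close> limit, so the limit of \<open>d(Pf\<^sub>k)\<close> is in the image.
\<close>

section \<open>Linear maps, quotients and isometries\<close>

lemma cring_real_ring: "cring real_ring"
proof (intro cringI abelian_groupI comm_monoidI)
  fix x assume "x \<in> carrier real_ring"
  show "\<exists>y\<in>carrier real_ring. y \<oplus>\<^bsub>real_ring\<^esub> x = \<zero>\<^bsub>real_ring\<^esub>"
    by (rule bexI[of _ "- x"]) (auto simp: real_ring_def)
qed (auto simp: real_ring_def algebra_simps)

definition linear_map ::
    "(real, 'a, 'c) module_scheme \<Rightarrow> (real, 'b, 'd) module_scheme \<Rightarrow> ('a \<Rightarrow> 'b) \<Rightarrow> bool" where
  "linear_map X Y T \<longleftrightarrow>
     T \<in> carrier X \<rightarrow> carrier Y \<and>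
     (\<forall>x\<in>carrier X. \<forall>y\<in>carrier X. T (x \<oplus>\<^bsub>X\<^esub> y) = T x \<oplus>\<^bsub>Y\<^esub> T y) \<and>
     (\<forall>a. \<forall>x\<in>carrier X. T (a \<odot>\<^bsub>X\<^esub> x) = a \<odot>\<^bsub>Y\<^esub> T x)"

locale linear_map_modules = X: module real_ring X + Y: module real_ring Y
  for X :: "(real, 'a, 'c) module_scheme" and Y :: "(real, 'b, 'd) module_scheme" +
  fixes T :: "'a \<Rightarrow> 'b"
  assumes linear: "linear_map X Y T"
begin

lemma closed [simp]: "x \<in> carrier X \<Longrightarrow> T x \<in> carrier Y"
  and add: "\<lbrakk>x \<in> carrier X; y \<in> carrier X\<rbrakk> \<Longrightarrow> T (x \<oplus>\<^bsub>X\<^esub> y) = T x \<oplus>\<^bsub>Y\<^esub> T y"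
  and smult: "x \<in> carrier X \<Longrightarrow> T (a \<odot>\<^bsub>X\<^esub> x) = a \<odot>\<^bsub>Y\<^esub> T x"
  using linear by (auto simp: linear_map_def)

lemma zero: "T \<zero>\<^bsub>X\<^esub> = \<zero>\<^bsub>Y\<^esub>"
  using add[of "\<zero>\<^bsub>X\<^esub>" "\<zero>\<^bsub>X\<^esub>"] by (metis X.M.zero_closed X.M.l_zero closed Y.M.add.r_cancel_one')

lemma uminus: "x \<in> carrier X \<Longrightarrow> T (\<ominus>\<^bsub>X\<^esub> x) = \<ominus>\<^bsub>Y\<^esub> T x"
  using add[of "\<ominus>\<^bsub>X\<^esub> x" x] by (metis X.M.a_inv_closed X.M.l_neg Y.M.minus_equality closed zero)

lemma diff: "\<lbrakk>x \<in> carrier X; y \<in> carrier X\<rbrakk> \<Longrightarrow> T (x \<ominus>\<^bsub>X\<^esub> y) = T x \<ominus>\<^bsub>Y\<^esub> T y"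
  by (simp add: X.M.minus_eq Y.M.minus_eq add uminus)

lemma eq_iff_diff:
  assumes x: "x \<in> carrier X" and y: "y \<in> carrier X"
  shows "T x = T y \<longleftrightarrow> T (x \<ominus>\<^bsub>X\<^esub> y) = \<zero>\<^bsub>Y\<^esub>"
proof -
  have "T x = (T x \<ominus>\<^bsub>Y\<^esub> T y) \<oplus>\<^bsub>Y\<^esub> T y"
    using x y by (simp add: Y.M.minus_eq Y.M.a_assoc Y.M.l_neg)
  then show ?thesis
    using x y by (metis Y.M.l_zero Y.M.minus_eq Y.M.r_neg closed diff)
qed

lemma submodule_kernel: "submodule {x \<in> carrier X. T x = \<zero>\<^bsub>Y\<^esub>} real_ring X"
  by (rule X.submoduleI) (auto simp: zero uminus add smult real_ring_def)

lemma submodule_image: "submodule (T ` carrier X) real_ring Y"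
  by (rule Y.submoduleI)
     (auto simp: real_ring_def simp flip: zero uminus add smult)

end

locale quotient_by_submodule = X: module real_ring X + N: submodule N real_ring X
  for X :: "(real, 'a, 'c) module_scheme" and N
begin

sublocale N: abelian_subgroup N X
  by (intro abelian_subgroupI3 additive_subgroupI N.subgroup_axioms X.M.abelian_group_axioms)

lemma quotient_carrier: "S \<in> carrier (quotient_module X N) \<longleftrightarrow> (\<exists>x\<in>carrier X. S = N +>\<^bsub>X\<^esub> x)"
  by (auto simp: quotient_module_def A_RCOSETS_def')

lemma quotient_add:
  "\<lbrakk>x \<in> carrier X; y \<in> carrier X\<rbrakk> \<Longrightarrow>
     (N +>\<^bsub>X\<^esub> x) \<oplus>\<^bsub>quotient_module X N\<^esub> (N +>\<^bsub>X\<^esub> y) = N +>\<^bsub>X\<^esub> (x \<oplus>\<^bsub>X\<^esub> y)"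
  by (simp add: quotient_module_def N.a_rcos_sum)

lemma quotient_zero: "\<zero>\<^bsub>quotient_module X N\<^esub> = N +>\<^bsub>X\<^esub> \<zero>\<^bsub>X\<^esub>"
  by (simp add: quotient_module_def N.a_subset)

lemma in_coset_iff:
  assumes "x \<in> carrier X"
  shows "y \<in> N +>\<^bsub>X\<^esub> x \<longleftrightarrow> y \<in> carrier X \<and> y \<ominus>\<^bsub>X\<^esub> x \<in> N"
proof
  assume "y \<in> N +>\<^bsub>X\<^esub> x"
  then obtain h where h: "h \<in> N" "y = h \<oplus>\<^bsub>X\<^esub> x" by (auto simp: a_r_coset_def')
  then have "h \<in> carrier X" using N.a_subset by auto
  then show "y \<in> carrier X \<and> y \<ominus>\<^bsub>X\<^esub> x \<in> N"
    using h assms by (simp add: X.M.minus_eq X.M.a_assoc X.M.r_neg)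
next
  assume y: "y \<in> carrier X \<and> y \<ominus>\<^bsub>X\<^esub> x \<in> N"
  then have "y = (y \<ominus>\<^bsub>X\<^esub> x) \<oplus>\<^bsub>X\<^esub> x"
    using assms by (simp add: X.M.minus_eq X.M.a_assoc X.M.l_neg)
  then show "y \<in> N +>\<^bsub>X\<^esub> x" using y by (auto simp: a_r_coset_def')
qed

lemma coset_eq_iff:
  assumes "x \<in> carrier X" "y \<in> carrier X"
  shows "N +>\<^bsub>X\<^esub> x = N +>\<^bsub>X\<^esub> y \<longleftrightarrow> x \<ominus>\<^bsub>X\<^esub> y \<in> N"
  by (metis N.a_rcos_self N.a_subgroup X.M.a_repr_independence assms in_coset_iff)

text \<open>
  The scalar multiple of a coset is a union over all its representatives; it is a single coset
  because \<open>N\<close> absorbs the multiples of the differences of representatives.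
\<close>

lemma quotient_smult:
  assumes "x \<in> carrier X"
  shows "a \<odot>\<^bsub>quotient_module X N\<^esub> (N +>\<^bsub>X\<^esub> x) = N +>\<^bsub>X\<^esub> (a \<odot>\<^bsub>X\<^esub> x)"
proof -
  have a: "a \<in> carrier real_ring" by (simp add: real_ring_def)
  have eq: "N +>\<^bsub>X\<^esub> (a \<odot>\<^bsub>X\<^esub> y) = N +>\<^bsub>X\<^esub> (a \<odot>\<^bsub>X\<^esub> x)" if y: "y \<in> N +>\<^bsub>X\<^esub> x" for y
  proof -
    have y': "y \<in> carrier X" "y \<ominus>\<^bsub>X\<^esub> x \<in> N" using in_coset_iff[OF assms] y by auto
    have "a \<odot>\<^bsub>X\<^esub> y \<ominus>\<^bsub>X\<^esub> a \<odot>\<^bsub>X\<^esub> x = a \<odot>\<^bsub>X\<^esub> (y \<ominus>\<^bsub>X\<^esub> x)"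
      using a y' assms by (simp add: X.M.minus_eq X.smult_r_distr X.smult_r_minus)
    also have "\<dots> \<in> N" using a y' N.smult_closed by blast
    finally show ?thesis using a y' assms by (simp add: coset_eq_iff)
  qed
  have "x \<in> N +>\<^bsub>X\<^esub> x" using assms by (rule N.a_rcos_self)
  then have "(\<Union>y \<in> N +>\<^bsub>X\<^esub> x. N +>\<^bsub>X\<^esub> (a \<odot>\<^bsub>X\<^esub> y)) = N +>\<^bsub>X\<^esub> (a \<odot>\<^bsub>X\<^esub> x)"
    using eq by blast
  then show ?thesis by (simp add: quotient_module_def)
qed

lemma module_quotient: "module real_ring (quotient_module X N)"
proof -
  let ?Q = "quotient_module X N"
  have r: "a \<in> carrier real_ring" for a by (simp add: real_ring_def)
  have cosetE: "\<exists>u\<in>carrier X. x = N +>\<^bsub>X\<^esub> u" if "x \<in> carrier ?Q" for x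
    using that by (simp add: quotient_carrier)
  have cosetI: "N +>\<^bsub>X\<^esub> u \<in> carrier ?Q" if "u \<in> carrier X" for u
    using that by (auto simp: quotient_carrier)
  note [simp] = quotient_add quotient_zero quotient_smult cosetI r
  show ?thesis
  proof (intro moduleI abelian_groupI cring_real_ring)
    fix x y z assume "x \<in> carrier ?Q" "y \<in> carrier ?Q" "z \<in> carrier ?Q"
    then obtain u v w where u: "u \<in> carrier X" "x = N +>\<^bsub>X\<^esub> u"
      and v: "v \<in> carrier X" "y = N +>\<^bsub>X\<^esub> v" and w: "w \<in> carrier X" "z = N +>\<^bsub>X\<^esub> w"
      using cosetE by metis
    then show "(x \<oplus>\<^bsub>?Q\<^esub> y) \<oplus>\<^bsub>?Q\<^esub> z = x \<oplus>\<^bsub>?Q\<^esub> (y \<oplus>\<^bsub>?Q\<^esub> z)"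
      by (simp add: X.M.a_assoc)
  next
    fix x y assume "x \<in> carrier ?Q" "y \<in> carrier ?Q"
    then obtain u v where u: "u \<in> carrier X" "x = N +>\<^bsub>X\<^esub> u"
      and v: "v \<in> carrier X" "y = N +>\<^bsub>X\<^esub> v"
      using cosetE by metis
    then show "x \<oplus>\<^bsub>?Q\<^esub> y \<in> carrier ?Q" "x \<oplus>\<^bsub>?Q\<^esub> y = y \<oplus>\<^bsub>?Q\<^esub> x"
      by (simp_all add: X.M.a_comm)
    show "a \<odot>\<^bsub>?Q\<^esub> (x \<oplus>\<^bsub>?Q\<^esub> y) = a \<odot>\<^bsub>?Q\<^esub> x \<oplus>\<^bsub>?Q\<^esub> a \<odot>\<^bsub>?Q\<^esub> y" for a
      using u v by (simp add: X.smult_r_distr)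
  next
    fix x assume "x \<in> carrier ?Q"
    then obtain u where u: "u \<in> carrier X" "x = N +>\<^bsub>X\<^esub> u"
      using cosetE by metis
    then show "\<zero>\<^bsub>?Q\<^esub> \<oplus>\<^bsub>?Q\<^esub> x = x" "\<one>\<^bsub>real_ring\<^esub> \<odot>\<^bsub>?Q\<^esub> x = x"
      by simp_all
    show "\<exists>y\<in>carrier ?Q. y \<oplus>\<^bsub>?Q\<^esub> x = \<zero>\<^bsub>?Q\<^esub>"
      using u by (intro bexI[of _ "N +>\<^bsub>X\<^esub> (\<ominus>\<^bsub>X\<^esub> u)"]) (simp_all add: X.M.l_neg)
    fix a b
    show "a \<odot>\<^bsub>?Q\<^esub> x \<in> carrier ?Q"
      "(a \<oplus>\<^bsub>real_ring\<^esub> b) \<odot>\<^bsub>?Q\<^esub> x = a \<odot>\<^bsub>?Q\<^esub> x \<oplus>\<^bsub>?Q\<^esub> b \<odot>\<^bsub>?Q\<^esub> x"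
      "(a \<otimes>\<^bsub>real_ring\<^esub> b) \<odot>\<^bsub>?Q\<^esub> x = a \<odot>\<^bsub>?Q\<^esub> (b \<odot>\<^bsub>?Q\<^esub> x)"
      using u by (simp_all add: X.smult_l_distr X.smult_assoc1)
  next
    show "\<zero>\<^bsub>?Q\<^esub> \<in> carrier ?Q" by simp
  qed
qed

end

text \<open>
  The linear form of the first isomorphism theorem: \<open>L\<close> factors through an injective linear map
  \<open>T\<close> on the quotient, and the norm put on the quotient is the one that makes \<open>T\<close> isometric. The
  norm axioms are pulled back along \<open>T\<close>; injectivity gives definiteness. A Cauchy sequence of
  cosets has a Cauchy image, whose limit stays in the closed range and is therefore the image of
  a coset.
\<close>

theorem isometric_quotient_by_kernel:
  fixes X :: "(real, 'a, 'c) module_scheme" and Y :: "(real, 'b, 'd) module_scheme"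
  assumes X: "module real_ring X" and Y: "banach_module Y nrm" and L: "linear_map X Y L"
    and closed: "closedin (Metric_space.mtopology (carrier Y) (norm_dist Y nrm)) (L ` carrier X)"
  defines "N \<equiv> {x \<in> carrier X. L x = \<zero>\<^bsub>Y\<^esub>}"
    and "qnrm \<equiv> \<lambda>S. nrm (L (SOME x. x \<in> S))"
  shows "\<forall>S \<in> carrier (quotient_module X N). \<forall>x \<in> S. qnrm S = nrm (L x)"
    and "banach_module (quotient_module X N) qnrm"
    and "closed_subspace (L ` carrier X) Y nrm"
    and "normed_isomorphic (quotient_module X N) qnrm (Y\<lparr>carrier := L ` carrier X\<rparr>) nrm"
proof -
  interpret Y: banach_module Y nrm by fact
  interpret L: linear_map_modules X Y L
    by (intro linear_map_modules.intro linear_map_modules_axioms.intro X L Y.module_axioms)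
  interpret quotient_by_submodule X N
    unfolding N_def by (intro quotient_by_submodule.intro X L.submodule_kernel)
  let ?Q = "quotient_module X N"
  define T where "T = (\<lambda>S. L (SOME x. x \<in> S))"
  have L_coset: "L y = L x" if "x \<in> carrier X" "y \<in> N +>\<^bsub>X\<^esub> x" for x y
    using in_coset_iff[THEN iffD1, OF that] L.eq_iff_diff[of y x] that(1) unfolding N_def by simp
  have T: "T (N +>\<^bsub>X\<^esub> x) = L x" if "x \<in> carrier X" for x
    unfolding T_def using that N.a_rcos_self[OF that] by (intro L_coset[OF that] someI)
  have r: "a \<in> carrier real_ring" for a by (simp add: real_ring_def)
  have qnrm: "qnrm = (\<lambda>S. nrm (T S))" by (simp add: qnrm_def T_def)
  have cosetE: "\<exists>x\<in>carrier X. S = N +>\<^bsub>X\<^esub> x" if "S \<in> carrier ?Q" for S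
    using that by (simp add: quotient_carrier)
  have cosetI: "N +>\<^bsub>X\<^esub> x \<in> carrier ?Q" if "x \<in> carrier X" for x
    using that by (auto simp: quotient_carrier)
  show "\<forall>S \<in> carrier ?Q. \<forall>x \<in> S. qnrm S = nrm (L x)"
  proof (intro ballI)
    fix S x assume S: "S \<in> carrier ?Q" and x: "x \<in> S"
    obtain u where u: "u \<in> carrier X" "S = N +>\<^bsub>X\<^esub> u" using cosetE[OF S] by blast
    then show "qnrm S = nrm (L x)" using L_coset x by (simp add: qnrm T)
  qed
  have "linear_map ?Q Y T"
    unfolding linear_map_def
  proof (intro conjI ballI allI funcsetI)
    fix S assume S: "S \<in> carrier ?Q"
    obtain u where u: "u \<in> carrier X" "S = N +>\<^bsub>X\<^esub> u" using cosetE[OF S] by blast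
    then show "T S \<in> carrier Y" by (simp add: T)
    show "T (a \<odot>\<^bsub>?Q\<^esub> S) = a \<odot>\<^bsub>Y\<^esub> T S" for a
      using u L.X.smult_closed[of a u] r[of a] by (simp add: T quotient_smult L.smult)
    fix S' assume S': "S' \<in> carrier ?Q"
    obtain v where "v \<in> carrier X" "S' = N +>\<^bsub>X\<^esub> v" using cosetE[OF S'] by blast
    then show "T (S \<oplus>\<^bsub>?Q\<^esub> S') = T S \<oplus>\<^bsub>Y\<^esub> T S'"
      using u by (simp add: T quotient_add L.add)
  qed
  then interpret T: linear_map_modules ?Q Y T
    by (intro linear_map_modules.intro linear_map_modules_axioms.intro module_quotient Y.module_axioms)
  have inj: "inj_on T (carrier ?Q)"
  proof (rule inj_onI)
    fix S S' assume S: "S \<in> carrier ?Q" and S': "S' \<in> carrier ?Q" and eq: "T S = T S'"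
    obtain u where u: "u \<in> carrier X" "S = N +>\<^bsub>X\<^esub> u" using cosetE[OF S] by blast
    obtain v where v: "v \<in> carrier X" "S' = N +>\<^bsub>X\<^esub> v" using cosetE[OF S'] by blast
    have "L u = L v" using eq T[OF u(1)] T[OF v(1)] unfolding u(2) v(2) by argo
    then have "u \<ominus>\<^bsub>X\<^esub> v \<in> N"
      unfolding N_def using L.eq_iff_diff[OF u(1) v(1)] L.X.M.minus_closed[OF u(1) v(1)] by blast
    then show "S = S'" unfolding u(2) v(2) using coset_eq_iff[OF u(1) v(1)] by blast
  qed
  have im: "T ` carrier ?Q = L ` carrier X"
  proof (intro equalityI subsetI)
    fix y assume "y \<in> T ` carrier ?Q"
    then obtain S where "S \<in> carrier ?Q" "y = T S" by blast
    then show "y \<in> L ` carrier X" using cosetE[of S] T by force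
  next
    fix y assume "y \<in> L ` carrier X"
    then obtain u where "u \<in> carrier X" "y = T (N +>\<^bsub>X\<^esub> u)" using T by force
    then show "y \<in> T ` carrier ?Q" using cosetI by blast
  qed
  interpret Q: normed_module ?Q qnrm
  proof (intro normed_module.intro normed_module_axioms.intro module_quotient)
    fix S assume S: "S \<in> carrier ?Q"
    show "qnrm S = 0 \<longleftrightarrow> S = \<zero>\<^bsub>?Q\<^esub>"
      using S inj_onD[OF inj, of S "\<zero>\<^bsub>?Q\<^esub>"]
      by (auto simp: qnrm Y.nrm_eq_0_iff T.zero T.X.M.zero_closed)
  qed (simp_all add: qnrm Y.nrm_nonneg Y.nrm_smult Y.nrm_triangle T.add T.smult)
  have dist: "norm_dist ?Q qnrm S S' = norm_dist Y nrm (T S) (T S')"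
    if "S \<in> carrier ?Q" "S' \<in> carrier ?Q" for S S'
    using that by (simp add: norm_dist_def qnrm T.diff)
  have "Q.mcomplete"
    unfolding Q.mcomplete_def
  proof (intro allI impI)
    fix \<sigma> assume \<sigma>: "Q.MCauchy \<sigma>"
    then have car: "\<sigma> n \<in> carrier ?Q" for n unfolding Q.MCauchy_def by blast
    then have "range (T \<circ> \<sigma>) \<subseteq> carrier Y" by force
    then have "Y.MCauchy (T \<circ> \<sigma>)"
      using \<sigma> car unfolding Q.MCauchy_def Y.MCauchy_def by (simp add: dist)
    then obtain y where y: "limitin Y.mtopology (T \<circ> \<sigma>) y sequentially"
      using Y.complete Y.mcomplete_def by blast
    moreover have "range (T \<circ> \<sigma>) \<subseteq> L ` carrier X"
      using car im by force
    ultimately have "y \<in> L ` carrier X"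
      using closed unfolding Y.metric_closedin_iff_sequentially_closed by blast
    then obtain S where S: "S \<in> carrier ?Q" "y = T S" using im by (metis imageE)
    have "limitin Q.mtopology \<sigma> S sequentially"
      using y S car unfolding Q.limit_metric_sequentially Y.limit_metric_sequentially
      by (simp add: dist)
    then show "\<exists>S. limitin Q.mtopology \<sigma> S sequentially" ..
  qed
  then show "banach_module ?Q qnrm"
    by unfold_locales
  show "closed_subspace (L ` carrier X) Y nrm"
    unfolding closed_subspace_def using closed L.submodule_image by blast
  have bij: "bij_betw T (carrier ?Q) (L ` carrier X)"
    using inj im by (simp add: bij_betw_def)
  have inv: "inv_into (carrier ?Q) T (T S) = S" if "S \<in> carrier ?Q" for S
    using inj that by simp
  show "normed_isomorphic ?Q qnrm (Y\<lparr>carrier := L ` carrier X\<rparr>) nrm"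
    unfolding normed_isomorphic_def
  proof (intro exI[of _ T] conjI)
    show "bounded_linear_map ?Q qnrm (Y\<lparr>carrier := L ` carrier X\<rparr>) nrm T"
      unfolding bounded_linear_map_def
    proof (intro conjI ballI allI funcsetI exI[of _ 1])
      show "T S \<in> carrier (Y\<lparr>carrier := L ` carrier X\<rparr>)" if "S \<in> carrier ?Q" for S
        using imageI[OF that, of T] unfolding im by simp
    qed (simp_all add: T.add T.smult qnrm)
    show "bounded_linear_map (Y\<lparr>carrier := L ` carrier X\<rparr>) nrm ?Q qnrm (inv_into (carrier ?Q) T)"
      unfolding bounded_linear_map_def
    proof (intro conjI ballI allI funcsetI exI[of _ 1])
      fix y assume "y \<in> carrier (Y\<lparr>carrier := L ` carrier X\<rparr>)"
      then have "y \<in> T ` carrier ?Q" unfolding im by simp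
      then obtain S where S: "S \<in> carrier ?Q" "y = T S" by blast
      then show "inv_into (carrier ?Q) T y \<in> carrier ?Q" "qnrm (inv_into (carrier ?Q) T y) \<le> 1 * nrm y"
        by (simp_all add: inv qnrm)
      show "inv_into (carrier ?Q) T (a \<odot>\<^bsub>Y\<lparr>carrier := L ` carrier X\<rparr>\<^esub> y)
          = a \<odot>\<^bsub>?Q\<^esub> inv_into (carrier ?Q) T y" for a
        using S inv[of "a \<odot>\<^bsub>?Q\<^esub> S"] T.X.smult_closed[OF r S(1)] by (simp add: inv T.smult)
      fix y' assume "y' \<in> carrier (Y\<lparr>carrier := L ` carrier X\<rparr>)"
      then have "y' \<in> T ` carrier ?Q" unfolding im by simp
      then obtain S' where S': "S' \<in> carrier ?Q" "y' = T S'" by blast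
      then show "inv_into (carrier ?Q) T (y \<oplus>\<^bsub>Y\<lparr>carrier := L ` carrier X\<rparr>\<^esub> y')
          = inv_into (carrier ?Q) T y \<oplus>\<^bsub>?Q\<^esub> inv_into (carrier ?Q) T y'"
        using S inv[of "S \<oplus>\<^bsub>?Q\<^esub> S'"] T.X.M.a_closed[OF S(1) S'(1)] by (simp add: inv T.add)
    qed
  qed (use bij in simp)
qed

lemma module_function_module:
  assumes "(\<lambda>_. 0) \<in> S"
    and "\<And>f g. \<lbrakk>f \<in> S; g \<in> S\<rbrakk> \<Longrightarrow> (\<lambda>x. f x + g x) \<in> S"
    and "\<And>a f. f \<in> S \<Longrightarrow> (\<lambda>x. a * f x) \<in> S"
  shows "module real_ring (function_module S)"
proof (intro moduleI abelian_groupI cring_real_ring)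
  fix f assume f: "f \<in> carrier (function_module S)"
  show "\<exists>g\<in>carrier (function_module S). g \<oplus>\<^bsub>function_module S\<^esub> f = \<zero>\<^bsub>function_module S\<^esub>"
    using assms(3)[of f "-1"] f by (intro bexI[of _ "\<lambda>x. -1 * f x"]) (auto simp: function_module_def)
qed (auto simp: function_module_def real_ring_def assms algebra_simps)

lemma function_module_minus:
  assumes "module real_ring (function_module S)" and f: "f \<in> S" and g: "g \<in> S"
  shows "f \<ominus>\<^bsub>function_module S\<^esub> g = (\<lambda>x. f x - g x)"
proof -
  interpret module real_ring "function_module S" by fact
  have g': "(\<lambda>x. -1 * g x) \<in> S"
    using smult_closed[of "-1" g] g by (simp add: function_module_def real_ring_def)
  have "\<ominus>\<^bsub>function_module S\<^esub> g = (\<lambda>x. -1 * g x)"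
    by (rule M.minus_equality) (use g g' in \<open>auto simp: function_module_def\<close>)
  then show ?thesis
    by (simp add: M.minus_eq) (simp add: function_module_def)
qed

section \<open>Completeness of weak \<open>\<ell>\<^sup>p\<close>\<close>

text \<open>
  The real supremum in \<^const>\<open>weak_lp_norm\<close> is junk for unbounded sets. All estimates are
  therefore made for the constants that bound it, with the power of the cardinality moved to the
  other side; then \<open>F = {}\<close> needs no exception.
\<close>

definition weak_lp_bound :: "real \<Rightarrow> 'm set \<Rightarrow> ('m \<Rightarrow> real) \<Rightarrow> real \<Rightarrow> bool" where
  "weak_lp_bound p M s K \<longleftrightarrow>
     (\<forall>F. F \<subseteq> M \<and> finite F \<longrightarrow> (\<Sum>j\<in>F. \<bar>s j\<bar>) \<le> K * real (card F) powr (1 - 1/p))"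

lemma weak_lp_boundD:
  "\<lbrakk>weak_lp_bound p M s K; F \<subseteq> M; finite F\<rbrakk> \<Longrightarrow> (\<Sum>j\<in>F. \<bar>s j\<bar>) \<le> K * real (card F) powr (1 - 1/p)"
  by (simp add: weak_lp_bound_def)

text \<open>
  Summed over \<open>n\<close> this bounds the partial sums of \<open>\<Sum> k powr (a - 1)\<close> by \<open>n powr a / a\<close>. It is
  concavity of \<open>x powr a\<close>, taken here from the weighted inequality of arithmetic and geometric
  means for \<open>1 - 1 / (n + 1)\<close> and \<open>1\<close>.
\<close>

lemma powr_increment_ge:
  fixes a :: real
  assumes "0 < a" "a < 1"
  shows "real n powr a + a * real (Suc n) powr (a - 1) \<le> real (Suc n) powr a"
proof -
  have "(1 - 1 / real (Suc n)) powr a \<le> 1 + a * (- 1 / real (Suc n))"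
  proof (cases "n = 0")
    case True then show ?thesis using assms by simp
  next
    case False
    define x where "x = 1 / real (Suc n)"
    have x: "0 < x" "x < 1" using False by (auto simp: x_def)
    have "(1 - x) powr a * 1 powr (1 - a) \<le> a * (1 - x) + (1 - a) * 1"
      using assms x by (intro Youngs_inequality_0) auto
    then show ?thesis by (simp add: x_def algebra_simps)
  qed
  then have "real (Suc n) powr a * (1 - 1 / real (Suc n)) powr a
      \<le> real (Suc n) powr a * (1 - a / real (Suc n))"
    by (intro mult_left_mono) auto
  moreover have "real (Suc n) powr a * (1 - 1 / real (Suc n)) powr a = real n powr a"
  proof -
    have "real (Suc n) * (1 - 1 / real (Suc n)) = real n" by (simp add: field_simps)
    then show ?thesis by (simp only: powr_mult[symmetric])
  qed
  moreover have "real (Suc n) powr (a - 1) = real (Suc n) powr a / real (Suc n)"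
    by (simp add: powr_diff)
  ultimately show ?thesis by (simp add: algebra_simps)
qed

text \<open>
  The least of \<open>n\<close> values of \<open>\<bar>s\<bar>\<close> is at most \<open>C n powr (- 1/p)\<close>, since \<open>\<bar>s\<bar>\<close> exceeds anything smaller
  at least \<open>n\<close> times. Removing the least value again and again, the sum of \<open>n\<close> values is at most
  \<open>C \<Sum> k powr (- 1/p)\<close>, which is where \<open>p > 1\<close> enters.
\<close>

lemma weak_lp_set_imp_bound:
  assumes p: "p > 1" and s: "s \<in> weak_lp_set p M"
  obtains K where "K \<ge> 0" "weak_lp_bound p M s K"
proof -
  from s obtain C where C: "C \<ge> 0" and fin: "\<And>t. t > 0 \<Longrightarrow> finite {m\<in>M. \<bar>s m\<bar> > t}"
    and card: "\<And>t. t > 0 \<Longrightarrow> real (card {m\<in>M. \<bar>s m\<bar> > t}) \<le> (C / t) powr p"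
    by (auto simp: weak_lp_set_def)
  define a where "a = 1 - 1/p"
  have a: "0 < a" "a < 1" using p by (auto simp: a_def)
  have least: "x \<le> C * real (card F) powr (a - 1)"
    if F: "F \<subseteq> M" "finite F" "F \<noteq> {}" and x: "\<And>j. j \<in> F \<Longrightarrow> x \<le> \<bar>s j\<bar>" for F x
  proof (rule field_le_mult_one_interval)
    \<comment> \<open>The level sets are defined by a strict inequality, so \<open>x\<close> is approached from below.\<close>
    fix z :: real assume z: "0 < z" "z < 1"
    have n: "real (card F) > 0" using F by (simp add: card_gt_0_iff)
    show "z * x \<le> C * real (card F) powr (a - 1)"
    proof (cases "x > 0")
      case True
      have "z * x < x" using z True by simp
      then have "F \<subseteq> {m\<in>M. \<bar>s m\<bar> > z * x}"
        using F x by (auto intro: less_le_trans)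
      then have "real (card F) \<le> (C / (z * x)) powr p"
        using card[of "z * x"] fin[of "z * x"] z True
        by (smt (verit) card_mono mult_pos_pos of_nat_mono)
      then have "real (card F) powr (1/p) \<le> ((C / (z * x)) powr p) powr (1/p)"
        using p n by (intro powr_mono2) auto
      also have "\<dots> = C / (z * x)"
        using C z True p by (simp add: powr_powr)
      finally have "z * x * real (card F) powr (1/p) \<le> C"
        using z True by (simp add: field_simps)
      then have "z * x \<le> C / real (card F) powr (1/p)"
        using n by (simp add: pos_le_divide_eq)
      also have "\<dots> = C * real (card F) powr (a - 1)"
        by (simp add: a_def powr_minus field_simps)
      finally show ?thesis .
    next
      case False
      then have "z * x \<le> 0" using z by (simp add: mult_nonneg_nonpos)
      also have "0 \<le> C * real (card F) powr (a - 1)" using C by simp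
      finally show ?thesis .
    qed
  qed
  have "(\<Sum>j\<in>F. \<bar>s j\<bar>) \<le> C / a * real n powr a" if "F \<subseteq> M" "finite F" "card F = n" for F n
    using that
  proof (induction n arbitrary: F)
    case 0
    then show ?case by simp
  next
    case (Suc n)
    then have ne: "F \<noteq> {}" by auto
    obtain j where j: "j \<in> F" "\<bar>s j\<bar> = Min ((\<lambda>j. \<bar>s j\<bar>) ` F)"
      using Min_in[of "(\<lambda>j. \<bar>s j\<bar>) ` F"] Suc.prems ne by (metis (no_types, lifting) finite_imageI image_iff image_is_empty)
    have "\<bar>s j\<bar> \<le> C * real (Suc n) powr (a - 1)"
      using least[of F "\<bar>s j\<bar>"] Suc.prems ne j by simp
    also have "\<dots> = C / a * (a * real (Suc n) powr (a - 1))" using a by simp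
    also have "\<dots> \<le> C / a * (real (Suc n) powr a - real n powr a)"
      using powr_increment_ge[OF a, of n] C a by (intro mult_left_mono) auto
    finally have "\<bar>s j\<bar> \<le> C / a * real (Suc n) powr a - C / a * real n powr a"
      by (simp add: right_diff_distrib)
    moreover have "(\<Sum>j\<in>F - {j}. \<bar>s j\<bar>) \<le> C / a * real n powr a"
      using Suc.prems j by (intro Suc.IH) auto
    ultimately show ?case
      using Suc.prems j by (simp add: sum.remove[of F j])
  qed
  then have "weak_lp_bound p M s (C / a)"
    by (simp add: weak_lp_bound_def a_def)
  then show ?thesis using C a by (intro that[of "C / a"]) auto
qed

text \<open>
  Chebyshev's inequality on finite sets \<open>F\<close> where \<open>\<bar>s\<bar> > t\<close>: their sum is at least \<open>t card F\<close>, so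
  \<open>card F\<close> is bounded, uniformly in \<open>F\<close>, and the whole level set is finite.
\<close>

lemma weak_lp_bound_imp_set:
  assumes p: "p > 1" and K: "weak_lp_bound p M s K" and s: "\<And>m. m \<notin> M \<Longrightarrow> s m = 0"
  shows "s \<in> weak_lp_set p M"
proof -
  have "finite {m\<in>M. \<bar>s m\<bar> > t} \<and> real (card {m\<in>M. \<bar>s m\<bar> > t}) \<le> (max K 0 / t) powr p"
    if t: "t > 0" for t
  proof -
    have bd: "real (card F) \<le> (max K 0 / t) powr p" if F: "F \<subseteq> {m\<in>M. \<bar>s m\<bar> > t}" "finite F" for F
    proof (cases "F = {}")
      case False
      then have n: "real (card F) > 0" using F by (simp add: card_gt_0_iff)
      have "real (card F) * t \<le> (\<Sum>j\<in>F. \<bar>s j\<bar>)"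
        using F by (intro sum_bounded_below) auto
      also have "\<dots> \<le> K * real (card F) powr (1 - 1/p)"
        using F by (intro weak_lp_boundD[OF K]) auto
      also have "\<dots> \<le> max K 0 * real (card F) powr (1 - 1/p)"
        by (intro mult_right_mono) auto
      also have "\<dots> = max K 0 * (real (card F) / real (card F) powr (1/p))"
        using n by (simp add: powr_diff)
      finally have "real (card F) powr (1/p) \<le> max K 0 / t"
        using n t by (simp add: field_simps)
      then have "(real (card F) powr (1/p)) powr p \<le> (max K 0 / t) powr p"
        using p by (intro powr_mono2) auto
      then show ?thesis using p n by (simp add: powr_powr)
    qed simp
    have "finite {m\<in>M. \<bar>s m\<bar> > t} \<and> card {m\<in>M. \<bar>s m\<bar> > t} \<le> nat \<lfloor>(max K 0 / t) powr p\<rfloor>"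
      by (rule finite_if_finite_subsets_card_bdd) (use bd in \<open>auto simp: le_nat_floor\<close>)
    then show ?thesis using bd by blast
  qed
  then show ?thesis
    unfolding weak_lp_set_def using s by (auto intro!: exI[of _ "max K 0"])
qed

lemma weak_lp_norm_le:
  assumes "weak_lp_bound p M s K" "M \<noteq> {}"
  shows "weak_lp_norm p M s \<le> K"
  unfolding weak_lp_norm_def
proof (rule cSup_least)
  obtain m where "m \<in> M" using assms by auto
  then show "{real n powr (- 1 + 1 / p) * (\<Sum>j\<in>F. \<bar>s j\<bar>) | n F. n \<ge> 1 \<and> F \<subseteq> M \<and> finite F \<and> card F = n} \<noteq> {}"
    by (auto intro!: exI[of _ "{m}"])
next
  fix x assume "x \<in> {real n powr (- 1 + 1 / p) * (\<Sum>j\<in>F. \<bar>s j\<bar>) | n F. n \<ge> 1 \<and> F \<subseteq> M \<and> finite F \<and> card F = n}"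
  then obtain F where F: "x = real (card F) powr (- 1 + 1 / p) * (\<Sum>j\<in>F. \<bar>s j\<bar>)"
    "card F \<ge> 1" "F \<subseteq> M" "finite F" by auto
  have "x \<le> real (card F) powr (- 1 + 1 / p) * (K * real (card F) powr (1 - 1/p))"
    unfolding F(1) by (intro mult_left_mono weak_lp_boundD[OF assms(1)] F) auto
  also have "\<dots> = K * real (card F) powr ((- 1 + 1 / p) + (1 - 1/p))"
    unfolding powr_add by simp
  also have "\<dots> = K" using F(2) by auto
  finally show "x \<le> K" .
qed

lemma weak_lp_norm_bound:
  assumes p: "p > 1" and s: "s \<in> weak_lp_set p M"
  shows "weak_lp_bound p M s (weak_lp_norm p M s)"
  unfolding weak_lp_bound_def
proof (intro allI impI)
  fix F assume F: "F \<subseteq> M \<and> finite F"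
  obtain K where K: "weak_lp_bound p M s K" using weak_lp_set_imp_bound[OF assms] .
  show "(\<Sum>j\<in>F. \<bar>s j\<bar>) \<le> weak_lp_norm p M s * real (card F) powr (1 - 1/p)"
  proof (cases "F = {}")
    case False
    then have n: "card F \<ge> 1" using F by (simp add: Suc_le_eq card_gt_0_iff)
    have eq: "real (card G) powr (- 1 + 1 / p) * real (card G) powr (1 - 1/p) = 1" if "card G \<ge> 1" for G :: "'a set"
      using that unfolding powr_add[symmetric] by simp
    have "real (card F) powr (- 1 + 1 / p) * (\<Sum>j\<in>F. \<bar>s j\<bar>) \<le> weak_lp_norm p M s"
      unfolding weak_lp_norm_def
    proof (rule cSup_upper)
      show "bdd_above {real n powr (- 1 + 1 / p) * (\<Sum>j\<in>F. \<bar>s j\<bar>) | n F. n \<ge> 1 \<and> F \<subseteq> M \<and> finite F \<and> card F = n}"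
      proof (rule bdd_aboveI)
        fix x assume "x \<in> {real n powr (- 1 + 1 / p) * (\<Sum>j\<in>F. \<bar>s j\<bar>) | n F. n \<ge> 1 \<and> F \<subseteq> M \<and> finite F \<and> card F = n}"
        then obtain G where G: "x = real (card G) powr (- 1 + 1 / p) * (\<Sum>j\<in>G. \<bar>s j\<bar>)"
          "card G \<ge> 1" "G \<subseteq> M" "finite G" by auto
        have "x \<le> real (card G) powr (- 1 + 1 / p) * (K * real (card G) powr (1 - 1/p))"
          unfolding G(1) by (intro mult_left_mono weak_lp_boundD[OF K] G) auto
        also have "\<dots> = K * (real (card G) powr (- 1 + 1 / p) * real (card G) powr (1 - 1/p))" by simp
        finally show "x \<le> K" using eq[OF G(2)] by simp
      qed
    qed (use F n in auto)
    then have "real (card F) powr (- 1 + 1 / p) * (\<Sum>j\<in>F. \<bar>s j\<bar>) * real (card F) powr (1 - 1/p)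
        \<le> weak_lp_norm p M s * real (card F) powr (1 - 1/p)"
      by (intro mult_right_mono) auto
    then show ?thesis using eq[OF n] by (simp add: mult.commute mult.left_commute)
  qed simp
qed

lemma weak_lp_norm_nonneg:
  assumes "p > 1" "s \<in> weak_lp_set p M" "M \<noteq> {}"
  shows "0 \<le> weak_lp_norm p M s"
proof -
  obtain m where "m \<in> M" using assms by auto
  then show ?thesis
    using weak_lp_boundD[OF weak_lp_norm_bound[OF assms(1,2)], of "{m}"] by simp
qed

lemma abs_le_weak_lp_norm:
  assumes "p > 1" "s \<in> weak_lp_set p M" "M \<noteq> {}"
  shows "\<bar>s m\<bar> \<le> weak_lp_norm p M s"
proof (cases "m \<in> M")
  case True
  then show ?thesis
    using weak_lp_boundD[OF weak_lp_norm_bound[OF assms(1,2)], of "{m}"] by simp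
next
  case False
  then have "s m = 0" using assms(2) by (auto simp: weak_lp_set_def)
  then show ?thesis using weak_lp_norm_nonneg[OF assms] by simp
qed

lemma weak_lp_bound_add:
  assumes "weak_lp_bound p M s K" "weak_lp_bound p M t L"
  shows "weak_lp_bound p M (\<lambda>x. s x + t x) (K + L)"
  unfolding weak_lp_bound_def
proof (intro allI impI)
  fix F assume F: "F \<subseteq> M \<and> finite F"
  have "(\<Sum>j\<in>F. \<bar>s j + t j\<bar>) \<le> (\<Sum>j\<in>F. \<bar>s j\<bar> + \<bar>t j\<bar>)" by (intro sum_mono abs_triangle_ineq)
  then show "(\<Sum>j\<in>F. \<bar>s j + t j\<bar>) \<le> (K + L) * real (card F) powr (1 - 1/p)"
    using weak_lp_boundD[OF assms(1), of F] weak_lp_boundD[OF assms(2), of F] F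
    by (simp add: sum.distrib distrib_right)
qed

lemma weak_lp_bound_smult:
  assumes "weak_lp_bound p M s K"
  shows "weak_lp_bound p M (\<lambda>x. a * s x) (\<bar>a\<bar> * K)"
  unfolding weak_lp_bound_def
proof (intro allI impI)
  fix F assume F: "F \<subseteq> M \<and> finite F"
  have "\<bar>a\<bar> * (\<Sum>j\<in>F. \<bar>s j\<bar>) \<le> \<bar>a\<bar> * (K * real (card F) powr (1 - 1/p))"
    using weak_lp_boundD[OF assms, of F] F by (intro mult_left_mono) auto
  then show "(\<Sum>j\<in>F. \<bar>a * s j\<bar>) \<le> \<bar>a\<bar> * K * real (card F) powr (1 - 1/p)"
    by (simp add: abs_mult sum_distrib_left mult.assoc)
qed

lemma weak_lp_set_off: "\<lbrakk>s \<in> weak_lp_set p M; m \<notin> M\<rbrakk> \<Longrightarrow> s m = 0"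
  by (auto simp: weak_lp_set_def)

lemma weak_lp_set_add:
  assumes "p > 1" "s \<in> weak_lp_set p M" "t \<in> weak_lp_set p M"
  shows "(\<lambda>x. s x + t x) \<in> weak_lp_set p M"
  by (rule weak_lp_bound_imp_set[OF assms(1) weak_lp_bound_add[OF weak_lp_norm_bound[OF assms(1,2)]
      weak_lp_norm_bound[OF assms(1,3)]]]) (simp add: weak_lp_set_off[OF assms(2)] weak_lp_set_off[OF assms(3)])

lemma weak_lp_set_smult:
  assumes "p > 1" "s \<in> weak_lp_set p M"
  shows "(\<lambda>x. a * s x) \<in> weak_lp_set p M"
  by (rule weak_lp_bound_imp_set[OF assms(1) weak_lp_bound_smult[OF weak_lp_norm_bound[OF assms]]])
     (simp add: weak_lp_set_off[OF assms(2)])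

lemma weak_lp_set_zero: "p > 1 \<Longrightarrow> (\<lambda>_. 0) \<in> weak_lp_set p M"
  by (rule weak_lp_bound_imp_set[of _ _ _ 0]) (auto simp: weak_lp_bound_def)

lemma module_weak_lp: "p > 1 \<Longrightarrow> module real_ring (weak_lp p M)"
  unfolding weak_lp_def
  by (intro module_function_module weak_lp_set_zero weak_lp_set_add weak_lp_set_smult)

lemma weak_lp_minus:
  assumes "p > 1" "s \<in> weak_lp_set p M" "t \<in> weak_lp_set p M"
  shows "s \<ominus>\<^bsub>weak_lp p M\<^esub> t = (\<lambda>x. s x - t x)"
  using function_module_minus[OF module_weak_lp[OF assms(1), of M, unfolded weak_lp_def]] assms
  by (simp add: weak_lp_def)

lemma weak_lp_simps [simp]:
  "carrier (weak_lp p M) = weak_lp_set p M"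
  "\<zero>\<^bsub>weak_lp p M\<^esub> = (\<lambda>_. 0)"
  "s \<oplus>\<^bsub>weak_lp p M\<^esub> t = (\<lambda>x. s x + t x)"
  "a \<odot>\<^bsub>weak_lp p M\<^esub> s = (\<lambda>x. a * s x)"
  by (simp_all add: weak_lp_def function_module_def)

lemma normed_module_weak_lp:
  assumes p: "p > 1" and M: "M \<noteq> {}"
  shows "normed_module (weak_lp p M) (weak_lp_norm p M)"
proof (intro normed_module.intro module_weak_lp p normed_module_axioms.intro, unfold weak_lp_simps)
  fix s t and a :: real
  assume s: "s \<in> weak_lp_set p M"
  note bd = weak_lp_norm_bound[OF p s]
  show "0 \<le> weak_lp_norm p M s" by (rule weak_lp_norm_nonneg[OF p s M])
  show "weak_lp_norm p M s = 0 \<longleftrightarrow> s = (\<lambda>_. 0)"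
  proof
    assume "weak_lp_norm p M s = 0"
    then show "s = (\<lambda>_. 0)" using abs_le_weak_lp_norm[OF p s M] by (auto simp: fun_eq_iff)
  next
    assume "s = (\<lambda>_. 0)"
    then have "weak_lp_norm p M s \<le> 0" by (intro weak_lp_norm_le M) (simp add: weak_lp_bound_def)
    then show "weak_lp_norm p M s = 0" using weak_lp_norm_nonneg[OF p s M] by simp
  qed
  have le: "weak_lp_norm p M (\<lambda>x. a * s x) \<le> \<bar>a\<bar> * weak_lp_norm p M s" if "s \<in> weak_lp_set p M" for a s
    by (intro weak_lp_norm_le weak_lp_bound_smult weak_lp_norm_bound p that M)
  show "weak_lp_norm p M (\<lambda>x. a * s x) = \<bar>a\<bar> * weak_lp_norm p M s"
  proof (cases "a = 0")
    case True
    have "weak_lp_norm p M (\<lambda>x. a * s x) \<ge> 0"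
      by (intro weak_lp_norm_nonneg weak_lp_set_smult p s M)
    then show ?thesis using True le[OF s, of a] by simp
  next
    case False
    then have "weak_lp_norm p M s \<le> \<bar>1 / a\<bar> * weak_lp_norm p M (\<lambda>x. a * s x)"
      using le[OF weak_lp_set_smult[OF p s, of a], of "1 / a"] by simp
    then have "\<bar>a\<bar> * weak_lp_norm p M s \<le> weak_lp_norm p M (\<lambda>x. a * s x)"
      using False by (simp add: field_simps)
    then show ?thesis using le[OF s, of a] by simp
  qed
  assume t: "t \<in> weak_lp_set p M"
  show "weak_lp_norm p M (\<lambda>x. s x + t x) \<le> weak_lp_norm p M s + weak_lp_norm p M t"
    by (intro weak_lp_norm_le weak_lp_bound_add weak_lp_norm_bound p s t M)
qed

lemma norm_dist_weak_lp:
  assumes "p > 1" "s \<in> weak_lp_set p M" "t \<in> weak_lp_set p M"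
  shows "norm_dist (weak_lp p M) (weak_lp_norm p M) s t = weak_lp_norm p M (\<lambda>x. s x - t x)"
  using assms by (simp add: norm_dist_def weak_lp_minus)

lemma weak_lp_set_diff:
  assumes "p > 1" "s \<in> weak_lp_set p M" "t \<in> weak_lp_set p M"
  shows "(\<lambda>x. s x - t x) \<in> weak_lp_set p M"
  using weak_lp_set_add[OF assms(1,2) weak_lp_set_smult[OF assms(1,3), of "-1"]] by simp

text \<open>
  A Cauchy sequence converges pointwise, because the norm dominates each value. The bounds of
  its differences involve finite sums only, so they survive the pointwise limit; this puts the
  limit into the space and gives convergence in norm.
\<close>

theorem banach_module_weak_lp:
  assumes p: "p > 1" and M: "M \<noteq> {}"
  shows "banach_module (weak_lp p M) (weak_lp_norm p M)"
proof -
  interpret normed_module "weak_lp p M" "weak_lp_norm p M"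
    by (rule normed_module_weak_lp[OF p M])
  have mcomplete
    unfolding mcomplete_def
  proof (intro allI impI)
    fix \<sigma> assume \<sigma>: "MCauchy \<sigma>"
    then have "range \<sigma> \<subseteq> carrier (weak_lp p M)" unfolding MCauchy_def by blast
    then have mem: "\<sigma> n \<in> weak_lp_set p M" for n by auto
    have cau: "\<exists>N. \<forall>n\<ge>N. \<forall>n'\<ge>N. weak_lp_norm p M (\<lambda>x. \<sigma> n x - \<sigma> n' x) < e" if "e > 0" for e
      using \<sigma> that unfolding MCauchy_def by (simp add: norm_dist_weak_lp[OF p mem mem])
    have "Cauchy (\<lambda>n. \<sigma> n x)" for x
    proof (rule metric_CauchyI)
      fix e :: real assume "e > 0"
      from cau[OF this] obtain N where
        N: "\<And>n n'. n \<ge> N \<Longrightarrow> n' \<ge> N \<Longrightarrow> weak_lp_norm p M (\<lambda>x. \<sigma> n x - \<sigma> n' x) < e" by blast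
      have "dist (\<sigma> m x) (\<sigma> n x) < e" if "m \<ge> N" "n \<ge> N" for m n
        using abs_le_weak_lp_norm[OF p weak_lp_set_diff[OF p mem[of m] mem[of n]] M, of x] N[OF that]
        by (simp add: dist_real_def)
      then show "\<exists>N. \<forall>m\<ge>N. \<forall>n\<ge>N. dist (\<sigma> m x) (\<sigma> n x) < e" by blast
    qed
    then have "(\<lambda>n. \<sigma> n x) \<longlonglongrightarrow> lim (\<lambda>n. \<sigma> n x)" for x
      by (simp add: Cauchy_convergent_iff convergent_LIMSEQ_iff)
    then obtain s where s: "\<And>x. (\<lambda>n. \<sigma> n x) \<longlonglongrightarrow> s x"
      by (rule that[of "\<lambda>x. lim (\<lambda>n. \<sigma> n x)"])
    have off: "s x = 0" if "x \<notin> M" for x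
      using s[of x] weak_lp_set_off[OF mem that] by (simp add: LIMSEQ_const_iff)
    have bd: "\<exists>N. \<forall>n\<ge>N. weak_lp_bound p M (\<lambda>x. \<sigma> n x - s x) e" if "e > 0" for e
    proof -
      from cau[OF that] obtain N where
        N: "\<And>n n'. n \<ge> N \<Longrightarrow> n' \<ge> N \<Longrightarrow> weak_lp_norm p M (\<lambda>x. \<sigma> n x - \<sigma> n' x) < e" by blast
      have "weak_lp_bound p M (\<lambda>x. \<sigma> n x - s x) e" if n: "n \<ge> N" for n
        unfolding weak_lp_bound_def
      proof (intro allI impI)
        fix F assume F: "F \<subseteq> M \<and> finite F"
        have "(\<lambda>n'. \<Sum>j\<in>F. \<bar>\<sigma> n j - \<sigma> n' j\<bar>) \<longlonglongrightarrow> (\<Sum>j\<in>F. \<bar>\<sigma> n j - s j\<bar>)"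
          by (intro tendsto_intros s)
        then show "(\<Sum>j\<in>F. \<bar>\<sigma> n j - s j\<bar>) \<le> e * real (card F) powr (1 - 1/p)"
        proof (rule LIMSEQ_le_const2)
          have "(\<Sum>j\<in>F. \<bar>\<sigma> n j - \<sigma> n' j\<bar>) \<le> e * real (card F) powr (1 - 1/p)" if "n' \<ge> N" for n'
          proof -
            have "(\<Sum>j\<in>F. \<bar>\<sigma> n j - \<sigma> n' j\<bar>)
              \<le> weak_lp_norm p M (\<lambda>x. \<sigma> n x - \<sigma> n' x) * real (card F) powr (1 - 1/p)"
              using weak_lp_boundD[OF weak_lp_norm_bound[OF p weak_lp_set_diff[OF p mem mem]]] F by blast
            also have "\<dots> \<le> e * real (card F) powr (1 - 1/p)"
              using N[OF n that] by (intro mult_right_mono) auto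
            finally show ?thesis .
          qed
          then show "\<exists>N. \<forall>n'\<ge>N. (\<Sum>j\<in>F. \<bar>\<sigma> n j - \<sigma> n' j\<bar>) \<le> e * real (card F) powr (1 - 1/p)" by blast
        qed
      qed
      then show ?thesis by blast
    qed
    have s_mem: "s \<in> weak_lp_set p M"
    proof -
      obtain N where "weak_lp_bound p M (\<lambda>x. \<sigma> N x - s x) 1" using bd[of 1] by auto
      then have "(\<lambda>x. \<sigma> N x - s x) \<in> weak_lp_set p M"
        by (rule weak_lp_bound_imp_set[OF p]) (use off weak_lp_set_off[OF mem] in simp)
      then show ?thesis using weak_lp_set_diff[OF p mem[of N]] by fastforce
    qed
    have "limitin mtopology \<sigma> s sequentially"
      unfolding limit_metric_sequentially
    proof (intro conjI allI impI)
      fix e :: real assume e: "e > 0"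
      then obtain N where N: "\<And>n. n \<ge> N \<Longrightarrow> weak_lp_bound p M (\<lambda>x. \<sigma> n x - s x) (e / 2)"
        using bd[of "e / 2"] by auto
      have "norm_dist (weak_lp p M) (weak_lp_norm p M) (\<sigma> n) s < e" if "n \<ge> N" for n
        using weak_lp_norm_le[OF N[OF that] M] e by (simp add: norm_dist_weak_lp[OF p mem s_mem])
      then show "\<exists>N. \<forall>n\<ge>N. \<sigma> n \<in> carrier (weak_lp p M) \<and>
          norm_dist (weak_lp p M) (weak_lp_norm p M) (\<sigma> n) s < e"
        using mem by auto
    qed (use s_mem in simp)
    then show "\<exists>s. limitin mtopology \<sigma> s sequentially" by blast
  qed
  then show ?thesis by unfold_locales
qed

section \<open>Convergence and approximation in \<open>L\<^sup>1\<close>\<close>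

text \<open>
  Completeness of \<open>L\<^sup>1\<close>. An almost everywhere convergent subsequence provides the limit, and
  Fatou's lemma along it turns the Cauchy estimates into estimates of the distance to the limit.
\<close>

lemma L1_Cauchy_convergent:
  fixes s :: "nat \<Rightarrow> 'a \<Rightarrow> real"
  assumes int: "\<And>n. integrable M (s n)"
    and cau: "\<And>e. e > 0 \<Longrightarrow> \<exists>N. \<forall>i\<ge>N. \<forall>j\<ge>N. (LINT x|M. \<bar>s i x - s j x\<bar>) < e"
  obtains f where "integrable M f" "(\<lambda>n. LINT x|M. \<bar>s n x - f x\<bar>) \<longlonglongrightarrow> 0"
proof -
  have [measurable]: "s n \<in> borel_measurable M" for n using int by auto
  obtain r where r: "strict_mono r" and AE_cau: "AE x in M. Cauchy (\<lambda>i. s (r i) x)"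
    using cauchy_L1_AE_cauchy_subseq[of M s] int cau by (auto simp: real_norm_def)
  define f where "f = (\<lambda>x. lim (\<lambda>i. s (r i) x))"
  have [measurable]: "f \<in> borel_measurable M" unfolding f_def by measurable
  have conv: "AE x in M. (\<lambda>i. s (r i) x) \<longlonglongrightarrow> f x"
    using AE_cau by eventually_elim (simp add: f_def Cauchy_convergent_iff convergent_LIMSEQ_iff)
  have bound: "(\<integral>\<^sup>+x. ennreal \<bar>s n x - f x\<bar> \<partial>M) \<le> ennreal e"
    if e: "e > 0" and N: "\<And>i j. i \<ge> N \<Longrightarrow> j \<ge> N \<Longrightarrow> (LINT x|M. \<bar>s i x - s j x\<bar>) < e" and n: "n \<ge> N" for e N n
  proof -
    have "(\<integral>\<^sup>+x. ennreal \<bar>s n x - f x\<bar> \<partial>M) = (\<integral>\<^sup>+x. liminf (\<lambda>i. ennreal \<bar>s n x - s (r i) x\<bar>) \<partial>M)"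
    proof (rule nn_integral_cong_AE)
      show "AE x in M. ennreal \<bar>s n x - f x\<bar> = liminf (\<lambda>i. ennreal \<bar>s n x - s (r i) x\<bar>)"
        using conv
      proof eventually_elim
        fix x assume "(\<lambda>i. s (r i) x) \<longlonglongrightarrow> f x"
        then have "(\<lambda>i. ennreal \<bar>s n x - s (r i) x\<bar>) \<longlonglongrightarrow> ennreal \<bar>s n x - f x\<bar>"
          by (intro tendsto_intros)
        then show "ennreal \<bar>s n x - f x\<bar> = liminf (\<lambda>i. ennreal \<bar>s n x - s (r i) x\<bar>)"
          by (rule lim_imp_Liminf[OF sequentially_bot, symmetric])
      qed
    qed
    also have "\<dots> \<le> liminf (\<lambda>i. \<integral>\<^sup>+x. ennreal \<bar>s n x - s (r i) x\<bar> \<partial>M)"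
      by (intro nn_integral_liminf) measurable
    also have "\<dots> \<le> limsup (\<lambda>i. \<integral>\<^sup>+x. ennreal \<bar>s n x - s (r i) x\<bar> \<partial>M)"
      by (intro Liminf_le_Limsup) simp
    also have "\<dots> \<le> ennreal e"
    proof (rule Limsup_bounded)
      have "(\<integral>\<^sup>+x. ennreal \<bar>s n x - s (r i) x\<bar> \<partial>M) \<le> ennreal e" if "i \<ge> N" for i
      proof -
        have "r i \<ge> N" using that strict_mono_imp_increasing[OF r, of i] by simp
        then have "(LINT x|M. \<bar>s n x - s (r i) x\<bar>) \<le> e" using N[OF n, of "r i"] by simp
        moreover have "(\<integral>\<^sup>+x. ennreal \<bar>s n x - s (r i) x\<bar> \<partial>M) = ennreal (LINT x|M. \<bar>s n x - s (r i) x\<bar>)"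
          using int by (intro nn_integral_eq_integral integrable_abs Bochner_Integration.integrable_diff) auto
        ultimately show ?thesis by (simp add: ennreal_leI)
      qed
      then show "\<forall>\<^sub>F i in sequentially. (\<integral>\<^sup>+x. ennreal \<bar>s n x - s (r i) x\<bar> \<partial>M) \<le> ennreal e"
        by (auto simp: eventually_sequentially)
    qed
    finally show ?thesis .
  qed
  have f_int: "integrable M f"
  proof -
    obtain N where N: "\<And>i j. i \<ge> N \<Longrightarrow> j \<ge> N \<Longrightarrow> (LINT x|M. \<bar>s i x - s j x\<bar>) < 1"
      using cau[of 1] by auto
    have "(\<integral>\<^sup>+x. ennreal \<bar>s N x - f x\<bar> \<partial>M) \<le> ennreal 1"
      by (rule bound[OF _ N]) auto
    then have "integrable M (\<lambda>x. s N x - f x)"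
      by (intro integrableI_bounded) (auto intro: le_less_trans)
    then have "integrable M (\<lambda>x. s N x - (s N x - f x))"
      by (rule Bochner_Integration.integrable_diff[OF int])
    then show ?thesis by simp
  qed
  have "(\<lambda>n. LINT x|M. \<bar>s n x - f x\<bar>) \<longlonglongrightarrow> 0"
  proof (rule LIMSEQ_I)
    fix e :: real assume e: "e > 0"
    obtain N where N: "\<And>i j. i \<ge> N \<Longrightarrow> j \<ge> N \<Longrightarrow> (LINT x|M. \<bar>s i x - s j x\<bar>) < e / 2"
      using cau[of "e / 2"] e by auto
    have "norm ((LINT x|M. \<bar>s n x - f x\<bar>) - 0) < e" if n: "n \<ge> N" for n
    proof -
      have "ennreal (LINT x|M. \<bar>s n x - f x\<bar>) = (\<integral>\<^sup>+x. ennreal \<bar>s n x - f x\<bar> \<partial>M)"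
        using int f_int by (intro nn_integral_eq_integral[symmetric] integrable_abs Bochner_Integration.integrable_diff) auto
      also have "\<dots> \<le> ennreal (e / 2)" using e by (intro bound[OF _ N n]) auto
      finally have "(LINT x|M. \<bar>s n x - f x\<bar>) \<le> e / 2" using e by (simp add: ennreal_le_iff)
      moreover have "(LINT x|M. \<bar>s n x - f x\<bar>) \<ge> 0" by (intro integral_nonneg_AE) auto
      ultimately show ?thesis using e by simp
    qed
    then show "\<exists>N. \<forall>n\<ge>N. norm ((LINT x|M. \<bar>s n x - f x\<bar>) - 0) < e" by blast
  qed
  with f_int show ?thesis by (rule that)
qed

lemma dominated_L1_convergence:
  fixes s :: "nat \<Rightarrow> 'a \<Rightarrow> real"
  assumes s: "\<And>n. integrable M (s n)" and f: "integrable M f" and w: "integrable M w"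
    and lim: "\<And>x. x \<in> space M \<Longrightarrow> (\<lambda>n. s n x) \<longlonglongrightarrow> f x"
    and dom: "\<And>n x. x \<in> space M \<Longrightarrow> \<bar>s n x\<bar> \<le> w x"
  shows "(\<lambda>n. LINT x|M. \<bar>s n x - f x\<bar>) \<longlonglongrightarrow> 0"
proof -
  have "(\<lambda>n. LINT x|M. \<bar>s n x - f x\<bar>) \<longlonglongrightarrow> (LINT x|M. 0)"
  proof (rule integral_dominated_convergence[where w="\<lambda>x. w x + \<bar>f x\<bar>"])
    show "AE x in M. (\<lambda>n. \<bar>s n x - f x\<bar>) \<longlonglongrightarrow> 0"
    proof (rule AE_I2)
      fix x assume "x \<in> space M"
      then have "(\<lambda>n. \<bar>s n x - f x\<bar>) \<longlonglongrightarrow> \<bar>f x - f x\<bar>" by (intro tendsto_intros lim)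
      then show "(\<lambda>n. \<bar>s n x - f x\<bar>) \<longlonglongrightarrow> 0" by simp
    qed
    show "AE x in M. norm \<bar>s n x - f x\<bar> \<le> w x + \<bar>f x\<bar>" for n
      using dom[of _ n] by (intro AE_I2) (smt (verit) real_norm_def)
    have "s n \<in> borel_measurable M" "f \<in> borel_measurable M" for n using s f by auto
    then show "(\<lambda>x. \<bar>s n x - f x\<bar>) \<in> borel_measurable M" for n by measurable
  qed (use w f in auto)
  then show ?thesis by simp
qed

text \<open>
  Density of the bounded Lipschitz functions in \<open>L\<^sup>1\<close>, as an induction rule. The indicator of a
  closed set is a limit of such functions. The Borel sets whose indicator has the property form
  a Dynkin system, and the closed sets are stable under intersections and generate the Borel
  sets, so all Borel indicators have it; simple functions and their limits follow.
\<close>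

theorem L1_induct_lipschitz [consumes 3, case_names lipschitz add scale lim]:
  fixes f :: "'a::metric_space \<Rightarrow> real"
  assumes fin: "finite_measure M" and sets: "sets M = sets borel" and f: "integrable M f"
    and lip: "\<And>g L. L-lipschitz_on UNIV g \<Longrightarrow> (\<And>x. \<bar>g x\<bar> \<le> 1) \<Longrightarrow> P g"
    and add: "\<And>g h. integrable M g \<Longrightarrow> P g \<Longrightarrow> integrable M h \<Longrightarrow> P h \<Longrightarrow> P (\<lambda>x. g x + h x)"
    and scale: "\<And>g c. integrable M g \<Longrightarrow> P g \<Longrightarrow> P (\<lambda>x. c * g x)"
    and lim: "\<And>s g. (\<And>n. integrable M (s n)) \<Longrightarrow> (\<And>n. P (s n)) \<Longrightarrow> integrable M g \<Longrightarrow>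
      (\<lambda>n. LINT x|M. \<bar>s n x - g x\<bar>) \<longlonglongrightarrow> 0 \<Longrightarrow> P g"
  shows "P f"
proof -
  interpret finite_measure M by fact
  have space: "space M = UNIV" using sets_eq_imp_space_eq[OF sets] by simp
  have int_ind: "integrable M (indicat_real A)" if "A \<in> sets borel" for A
    using that sets by (auto intro!: integrable_real_indicator simp: less_top[symmetric])
  have const: "P (\<lambda>_. c)" if "\<bar>c\<bar> \<le> 1" for c :: real
    using that by (intro lip[of 0]) (auto simp: lipschitz_on_def)
  have ind: "P (indicat_real A)" if "A \<in> sets borel" for A
  proof -
    have "Int_stable (Collect closed :: 'a set set)" "Collect closed \<subseteq> Pow (UNIV :: 'a set)"
      "A \<in> sigma_sets UNIV (Collect closed)"
      using that by (auto simp: borel_eq_closed Int_stable_def)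
    then show ?thesis
    proof (induction rule: sigma_sets_induct_disjoint)
      case (basic A)
      then have A: "closed A" by simp
      show ?case
      proof (cases "A = {}")
        case False
        \<comment> \<open>Equal to 1 on \<open>A\<close> and to 0 at distance at least \<open>1 / k\<close> from \<open>A\<close>.\<close>
        define \<phi> where "\<phi> = (\<lambda>k x. max 0 (1 - real k * infdist x A))"
        have b: "0 \<le> \<phi> k x" "\<phi> k x \<le> 1" for k x by (auto simp: \<phi>_def infdist_nonneg)
        have L: "(real k)-lipschitz_on UNIV (\<phi> k)" for k
        proof (rule lipschitz_onI)
          fix x y
          have "\<bar>infdist x A - infdist y A\<bar> \<le> dist x y" by (rule infdist_triangle_abs)
          then have "real k * \<bar>infdist x A - infdist y A\<bar> \<le> real k * dist x y"
            by (intro mult_left_mono) auto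
          then have "\<bar>real k * infdist x A - real k * infdist y A\<bar> \<le> real k * dist x y"
            by (simp add: abs_mult flip: right_diff_distrib)
          then show "dist (\<phi> k x) (\<phi> k y) \<le> real k * dist x y"
            by (simp add: \<phi>_def dist_real_def abs_le_iff max_def)
        qed simp
        have \<phi>_int: "integrable M (\<phi> k)" for k
        proof (rule integrable_const_bound[of _ 1])
          have "continuous_on UNIV (\<phi> k)" using L lipschitz_on_continuous_on by blast
          then have "\<phi> k \<in> borel_measurable borel" by (rule borel_measurable_continuous_onI)
          then show "\<phi> k \<in> borel_measurable M" using sets by (simp cong: measurable_cong_sets)
        qed (use b in auto)
        show ?thesis
        proof (rule lim[of \<phi>])
          show "P (\<phi> k)" for k using b by (intro lip[OF L]) simp
          show "(\<lambda>n. LINT x|M. \<bar>\<phi> n x - indicat_real A x\<bar>) \<longlonglongrightarrow> 0"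
          proof (rule dominated_L1_convergence[where w="\<lambda>_. 1"])
            fix x
            show "(\<lambda>n. \<phi> n x) \<longlonglongrightarrow> indicat_real A x"
            proof (cases "x \<in> A")
              case True
              then show ?thesis by (simp add: \<phi>_def)
            next
              case False
              then have d: "infdist x A > 0"
                using A \<open>A \<noteq> {}\<close> by (simp add: infdist_pos_not_in_closed)
              obtain N :: nat where N: "1 / infdist x A < real N" using reals_Archimedean2 by blast
              have "\<phi> n x = 0" if "n \<ge> N" for n
              proof -
                have "1 < real N * infdist x A" using N d by (simp add: field_simps)
                also have "\<dots> \<le> real n * infdist x A" using that d by (intro mult_right_mono) auto
                finally show ?thesis by (simp add: \<phi>_def)
              qed
              then have "\<forall>\<^sub>F n in sequentially. \<phi> n x = 0" by (auto simp: eventually_sequentially)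
              then show ?thesis using False by (simp add: tendsto_eventually)
            qed
            show "\<bar>\<phi> n x\<bar> \<le> 1" for n using b[of n x] by simp
          qed (use \<phi>_int int_ind A in auto)
        qed (use \<phi>_int int_ind A in auto)
      next
        case True
        have "indicat_real {} = (\<lambda>x::'a. 0)" by (auto simp: fun_eq_iff)
        then show ?thesis using True const[of 0] by simp
      qed
    next
      case empty
      have "indicat_real {} = (\<lambda>x::'a. 0)" by (auto simp: fun_eq_iff)
      then show ?case using const[of 0] by simp
    next
      case (compl A)
      then have A: "A \<in> sets borel" by (simp add: borel_eq_closed)
      have "P (\<lambda>x. 1 + (-1) * indicat_real A x)"
        by (intro add scale const compl) (auto intro!: int_ind A Bochner_Integration.integrable_minus)
      moreover have "indicat_real (UNIV - A) = (\<lambda>x. 1 + (-1) * indicat_real A x)"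
        by (auto simp: fun_eq_iff indicator_def)
      ultimately show ?case by simp
    next
      case (union A)
      then have A: "A i \<in> sets borel" for i by (auto simp: borel_eq_closed)
      have sum: "P (\<lambda>x. \<Sum>i<n. indicat_real (A i) x)" for n
      proof (induction n)
        case 0
        then show ?case using const[of 0] by simp
      next
        case (Suc n)
        show ?case
          by (simp, intro add Suc.IH union) (auto intro!: int_ind A)
      qed
      show ?case
      proof (rule lim[OF _ sum])
        have eq: "(\<Sum>i<n. indicat_real (A i) x) = indicat_real (\<Union>i<n. A i) x" for n x
          using union(1) by (subst indicator_UN_disjoint) (auto simp: disjoint_family_on_def)
        show "(\<lambda>n. LINT x|M. \<bar>(\<Sum>i<n. indicat_real (A i) x) - indicat_real (\<Union>i. A i) x\<bar>) \<longlonglongrightarrow> 0"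
        proof (rule dominated_L1_convergence[where w="\<lambda>_. 1"])
          fix x
          show "(\<lambda>n. \<Sum>i<n. indicat_real (A i) x) \<longlonglongrightarrow> indicat_real (\<Union>i. A i) x"
            unfolding eq by (rule LIMSEQ_indicator_UN)
          show "\<bar>\<Sum>i<n. indicat_real (A i) x\<bar> \<le> 1" for n
            unfolding eq by (simp add: indicator_def)
        qed (auto intro!: int_ind A)
      qed (auto intro!: int_ind A)
    qed
  qed
  from f show ?thesis
  proof (induction rule: integrable_induct)
    case (base A c)
    have A: "A \<in> sets borel" using base sets by simp
    show ?case using scale[OF int_ind[OF A] ind[OF A], of c] by (simp add: mult.commute)
  next
    case (add f g)
    then show ?case by (intro assms(5))
  next
    case (lim f s)
    show ?case
    proof (rule assms(7)[of s])
      show "(\<lambda>n. LINT x|M. \<bar>s n x - f x\<bar>) \<longlonglongrightarrow> 0"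
        using lim by (intro dominated_L1_convergence[where w="\<lambda>x. 2 * \<bar>f x\<bar>"]) auto
    qed (use lim in auto)
  qed
qed

section \<open>A Poincare inequality for covers of bounded overlap\<close>

text \<open>
  What the Poincare inequality uses of a hyperbolic filling: up to constants, there are at most \<open>q ^ n\<close>
  balls of level \<open>n\<close>, each of measure at most \<open>1 / q ^ n\<close>; each point and each ball of the next level meets boundedly
  many of them, and their diameters tend to 0. In a space of dimension \<open>Q\<close>, \<open>q = 2 powr Q\<close>.
\<close>

locale bounded_overlap_covers = finite_measure M
  for M :: "'z::metric_space measure" +
  fixes V :: "nat \<Rightarrow> 'z set set" and K q :: real
  assumes sets_eq_borel: "sets M = sets borel"
    and q_gt_1: "q > 1"
    and finite_V: "finite (V n)"
    and V_borel: "B \<in> V n \<Longrightarrow> B \<in> sets borel"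
    and V_pos: "B \<in> V n \<Longrightarrow> 0 < measure M B"
    and V_covers: "\<exists>B\<in>V n. x \<in> B"
    and V_overlap: "real (card {B \<in> V n. x \<in> B}) \<le> K"
    and V_measure: "B \<in> V n \<Longrightarrow> measure M B \<le> K / q ^ n"
    and V_card: "real (card (V n)) \<le> K * q ^ n"
    and V_diam: "\<lbrakk>B \<in> V n; x \<in> B; y \<in> B\<rbrakk> \<Longrightarrow> dist x y \<le> 4 / 2 ^ n"
    and V_neighbours: "B \<in> V (Suc n) \<Longrightarrow> real (card {B' \<in> V n. B \<inter> B' \<noteq> {}}) \<le> K"
    and V_0: "V 0 = {UNIV}"
begin

lemma space_UNIV: "space M = UNIV"
  using sets_eq_imp_space_eq[OF sets_eq_borel] by simp

declare sets_eq_borel [simp]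

definition avg :: "('z \<Rightarrow> real) \<Rightarrow> 'z set \<Rightarrow> real" where
  "avg f B = (LINT x:B|M. f x) / measure M B"

definition overlap_count :: "nat \<Rightarrow> 'z \<Rightarrow> real" where
  "overlap_count n x = real (card {B \<in> V n. x \<in> B})"

text \<open>
  The mean of the averages over the sets of level \<open>n\<close> that contain \<open>x\<close>: a measurable way to
  extend the Poisson extension at level \<open>n\<close> back to a function on the space.
\<close>

definition approx :: "nat \<Rightarrow> ('z \<Rightarrow> real) \<Rightarrow> 'z \<Rightarrow> real" where
  "approx n f x = (\<Sum>B\<in>V n. indicat_real B x * avg f B) / overlap_count n x"

lemma overlap_count_eq: "overlap_count n x = (\<Sum>B\<in>V n. indicat_real B x)"
  unfolding overlap_count_def using finite_V[of n]
  by (simp add: indicator_def sum.If_cases Int_def)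

lemma overlap_count_ge_1: "1 \<le> overlap_count n x"
proof -
  obtain B where "B \<in> V n" "x \<in> B" using V_covers by blast
  then have "{B \<in> V n. x \<in> B} \<noteq> {}" by blast
  then have "card {B \<in> V n. x \<in> B} > 0" using finite_V[of n] by (simp add: card_gt_0_iff)
  then show ?thesis unfolding overlap_count_def by simp
qed

lemma K_ge_1: "1 \<le> K"
  using overlap_count_ge_1[of 0 undefined] V_overlap[of 0 undefined] unfolding overlap_count_def by linarith

lemma integrable_abs_diff:
  "integrable M f \<Longrightarrow> integrable M g \<Longrightarrow> integrable M (\<lambda>x. \<bar>f x - g x\<bar>)" for f g :: "'z \<Rightarrow> real"
  by (intro integrable_abs Bochner_Integration.integrable_diff)

lemma integrable_on_borel:
  "integrable M f \<Longrightarrow> B \<in> sets borel \<Longrightarrow> set_integrable M B f" for f :: "'z \<Rightarrow> real"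
  using integrable_real_mult_indicator[of B M f] by (simp add: set_integrable_def mult.commute)

lemma integrable_ind: "B \<in> sets borel \<Longrightarrow> integrable M (indicat_real B)"
  by (auto intro!: integrable_real_indicator simp: less_top[symmetric])

lemma measurable_approx [measurable]: "approx n f \<in> borel_measurable M"
proof -
  have [measurable]: "indicat_real B \<in> borel_measurable M" if "B \<in> V n" for B
    using V_borel[OF that] by (intro borel_measurable_indicator) simp
  show ?thesis unfolding approx_def overlap_count_eq by measurable
qed

lemma avg_add: "\<lbrakk>integrable M f; integrable M g; B \<in> sets borel\<rbrakk> \<Longrightarrow>
    avg (\<lambda>x. f x + g x) B = avg f B + avg g B"
  unfolding avg_def by (simp add: set_integral_add integrable_on_borel add_divide_distrib)

lemma avg_scale: "avg (\<lambda>x. c * f x) B = c * avg f B"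
  unfolding avg_def by simp

lemma avg_diff: "\<lbrakk>integrable M f; integrable M g; B \<in> sets borel\<rbrakk> \<Longrightarrow>
    avg (\<lambda>x. f x - g x) B = avg f B - avg g B"
  unfolding avg_def by (simp add: set_integral_diff integrable_on_borel diff_divide_distrib)

lemma abs_avg_le: "B \<in> V n \<Longrightarrow> measure M B * \<bar>avg f B\<bar> \<le> (LINT x:B|M. \<bar>f x\<bar>)"
  using V_pos[of B n] integral_abs_bound[of M "\<lambda>x. indicat_real B x * f x"]
  by (simp add: avg_def set_lebesgue_integral_def abs_divide abs_mult)

lemma avg_const: "B \<in> V n \<Longrightarrow> avg (\<lambda>x. c) B = c"
  using V_pos[of B n] V_borel[of B n] unfolding avg_def by (simp add: set_lebesgue_integral_def)

lemma approx_add: "\<lbrakk>integrable M f; integrable M g\<rbrakk> \<Longrightarrow>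
    approx n (\<lambda>x. f x + g x) x = approx n f x + approx n g x"
  unfolding approx_def add_divide_distrib[symmetric] sum.distrib[symmetric]
  by (intro arg_cong2[where f="(/)"] refl sum.cong) (simp add: avg_add V_borel distrib_left)

lemma approx_diff: "\<lbrakk>integrable M f; integrable M g\<rbrakk> \<Longrightarrow>
    approx n (\<lambda>x. f x - g x) x = approx n f x - approx n g x"
  unfolding approx_def diff_divide_distrib[symmetric] sum_subtractf[symmetric]
  by (intro arg_cong2[where f="(/)"] refl sum.cong) (simp add: avg_diff V_borel right_diff_distrib)

lemma approx_scale: "approx n (\<lambda>x. c * f x) x = c * approx n f x"
  unfolding approx_def avg_scale by (simp add: sum_distrib_left mult_ac)

lemma abs_approx_le: "\<bar>approx n f x\<bar> \<le> (\<Sum>B\<in>V n. indicat_real B x * \<bar>avg f B\<bar>)"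
proof -
  have "\<bar>approx n f x\<bar> = \<bar>\<Sum>B\<in>V n. indicat_real B x * avg f B\<bar> / overlap_count n x"
    using overlap_count_ge_1[of n x] unfolding approx_def by (simp add: abs_divide)
  also have "\<dots> \<le> \<bar>\<Sum>B\<in>V n. indicat_real B x * avg f B\<bar> / 1"
    using overlap_count_ge_1[of n x] by (intro divide_left_mono) auto
  also have "\<dots> \<le> (\<Sum>B\<in>V n. \<bar>indicat_real B x * avg f B\<bar>)" by simp
  finally show ?thesis by (simp add: abs_mult)
qed

lemma integrable_ind_sum:
  "finite S \<Longrightarrow> (\<And>i. i \<in> S \<Longrightarrow> A i \<in> sets borel) \<Longrightarrow> integrable M (\<lambda>x. \<Sum>i\<in>S. indicat_real (A i) x * c i)"
  by (intro Bochner_Integration.integrable_sum integrable_mult_left integrable_ind)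

lemma integrable_approx: "integrable M (approx n f)"
  by (rule Bochner_Integration.integrable_bound[OF integrable_ind_sum[of "V n" "\<lambda>B. B" "\<lambda>B. \<bar>avg f B\<bar>"]])
     (use abs_approx_le finite_V V_borel in \<open>auto intro: order_trans\<close>)

text \<open>
  Dropping the denominator, the left side is at most the sum of the integrals of \<open>\<bar>f\<bar>\<close> over the
  sets of level \<open>n\<close>, and these sets cover each point at most \<open>K\<close> times. The bound is uniform in
  \<open>n\<close>, which is what extends convergence from a dense class to all of \<open>L\<^sup>1\<close>.
\<close>

lemma L1_approx_le:
  assumes f: "integrable M f"
  shows "(LINT x|M. \<bar>approx n f x\<bar>) \<le> K * (LINT x|M. \<bar>f x\<bar>)"
proof -
  have "(LINT x|M. \<bar>approx n f x\<bar>) \<le> (LINT x|M. (\<Sum>B\<in>V n. indicat_real B x * \<bar>avg f B\<bar>))"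
    by (intro integral_mono integrable_ind_sum finite_V V_borel abs_approx_le integrable_abs integrable_approx)
  also have "\<dots> = (\<Sum>B\<in>V n. measure M B * \<bar>avg f B\<bar>)"
    by (subst Bochner_Integration.integral_sum)
       (auto intro!: integrable_ind V_borel simp: space_UNIV)
  also have "\<dots> \<le> (\<Sum>B\<in>V n. LINT x|M. indicat_real B x * \<bar>f x\<bar>)"
    by (intro sum_mono) (use abs_avg_le in \<open>simp add: set_lebesgue_integral_def\<close>)
  also have "\<dots> = (LINT x|M. overlap_count n x * \<bar>f x\<bar>)"
    unfolding overlap_count_eq sum_distrib_right
    by (subst Bochner_Integration.integral_sum)
       (use integrable_on_borel[OF integrable_abs[OF f]] V_borel in \<open>auto simp: set_integrable_def\<close>)
  also have "\<dots> \<le> (LINT x|M. K * \<bar>f x\<bar>)"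
  proof (rule integral_mono)
    show "integrable M (\<lambda>x. overlap_count n x * \<bar>f x\<bar>)"
      unfolding overlap_count_eq sum_distrib_right
      using integrable_on_borel[OF integrable_abs[OF f]] V_borel
      by (intro Bochner_Integration.integrable_sum) (auto simp: set_integrable_def)
  qed (use f V_overlap in \<open>auto intro: mult_right_mono simp: overlap_count_def\<close>)
  finally show ?thesis by simp
qed

lemma approx_lipschitz:
  assumes L: "L-lipschitz_on UNIV g" and g: "integrable M g"
  shows "\<bar>approx n g x - g x\<bar> \<le> L * (4 / 2 ^ n)"
proof -
  have ge0: "L \<ge> 0" using L by (rule lipschitz_on_nonneg)
  have avg: "\<bar>avg g B - g x\<bar> \<le> L * (4 / 2 ^ n)" if B: "B \<in> V n" "x \<in> B" for B
  proof -
    have "avg g B - g x = avg (\<lambda>y. g y - g x) B"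
      using g B by (simp add: avg_diff avg_const V_borel)
    then have "measure M B * \<bar>avg g B - g x\<bar> \<le> (LINT y:B|M. \<bar>g y - g x\<bar>)"
      using abs_avg_le[OF B(1)] by simp
    also have "\<dots> \<le> (LINT y:B|M. L * (4 / 2 ^ n))"
    proof (rule set_integral_mono)
      fix y assume y: "y \<in> B"
      have "\<bar>g y - g x\<bar> \<le> L * dist y x"
        using lipschitz_onD[OF L, of y x] by (simp add: dist_real_def)
      also have "\<dots> \<le> L * (4 / 2 ^ n)" by (intro mult_left_mono V_diam[OF B(1) y B(2)] ge0)
      finally show "\<bar>g y - g x\<bar> \<le> L * (4 / 2 ^ n)" .
    qed (use g B V_borel in \<open>auto intro!: integrable_on_borel\<close>)
    also have "\<dots> = measure M B * (L * (4 / 2 ^ n))"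
      using V_borel[OF B(1)] by (simp add: set_lebesgue_integral_def)
    finally show ?thesis by (rule mult_left_le_imp_le[OF _ V_pos[OF B(1)]])
  qed
  have pos: "overlap_count n x > 0" using overlap_count_ge_1[of n x] by simp
  have "approx n g x - g x = (\<Sum>B\<in>V n. indicat_real B x * (avg g B - g x)) / overlap_count n x"
    using pos unfolding approx_def by (simp add: field_simps sum_subtractf overlap_count_eq sum_distrib_left)
  also have "\<bar>\<dots>\<bar> \<le> (\<Sum>B\<in>V n. \<bar>indicat_real B x * (avg g B - g x)\<bar>) / overlap_count n x"
    using pos by (simp add: abs_divide divide_right_mono)
  also have "\<dots> \<le> (\<Sum>B\<in>V n. indicat_real B x * (L * (4 / 2 ^ n))) / overlap_count n x"
    using pos avg by (intro divide_right_mono sum_mono) (auto simp: indicator_def abs_mult)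
  also have "\<dots> = L * (4 / 2 ^ n)"
    using pos unfolding sum_distrib_right[symmetric] overlap_count_eq[symmetric] by simp
  finally show ?thesis .
qed

text \<open>
  The substitute for Lebesgue's differentiation theorem. For Lipschitz functions the
  convergence is uniform by \<open>approx_lipschitz\<close>, and by \<open>L1_approx_le\<close> the class of functions with
  this property is closed in \<open>L\<^sup>1\<close>.
\<close>

theorem approx_tendsto_L1:
  assumes "integrable M f"
  shows "(\<lambda>n. LINT x|M. \<bar>approx n f x - f x\<bar>) \<longlonglongrightarrow> 0"
  using finite_measure_axioms sets_eq_borel assms
proof (induction rule: L1_induct_lipschitz)
  case (lipschitz g L)
  have "continuous_on UNIV g" using lipschitz lipschitz_on_continuous_on by blast
  then have "g \<in> borel_measurable borel" by (rule borel_measurable_continuous_onI)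
  then have "g \<in> borel_measurable M" using sets_eq_borel by (simp cong: measurable_cong_sets)
  then have g: "integrable M g"
    by (intro integrable_const_bound[of _ 1]) (use lipschitz in auto)
  show ?case
  proof (rule tendsto_sandwich[OF _ _ tendsto_const])
    have "(LINT x|M. \<bar>approx n g x - g x\<bar>) \<le> (LINT x|M. L * (4 / 2 ^ n))" for n
      using g by (intro integral_mono approx_lipschitz[OF lipschitz(1)] integrable_abs
          Bochner_Integration.integrable_diff integrable_approx) auto
    then show "\<forall>\<^sub>F n in sequentially. (LINT x|M. \<bar>approx n g x - g x\<bar>) \<le> measure M (space M) * (L * (4 * (1 / 2) ^ n))"
      by (simp add: power_divide mult_ac)
    have "(\<lambda>n. measure M (space M) * (L * (4 * (1 / 2) ^ n))) \<longlonglongrightarrow> measure M (space M) * (L * (4 * 0))"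
      by (intro tendsto_intros LIMSEQ_realpow_zero) auto
    then show "(\<lambda>n. measure M (space M) * (L * (4 * (1 / 2) ^ n))) \<longlonglongrightarrow> 0" by simp
  qed (auto intro!: always_eventually integral_nonneg_AE)
next
  case (add g h)
  show ?case
  proof (rule tendsto_sandwich[OF _ _ tendsto_const])
    have i: "integrable M (\<lambda>x. \<bar>approx n g x - g x\<bar>)" "integrable M (\<lambda>x. \<bar>approx n h x - h x\<bar>)" for n
      using add.hyps by (auto intro!: integrable_approx)
    have "(LINT x|M. \<bar>approx n (\<lambda>x. g x + h x) x - (g x + h x)\<bar>)
        \<le> (LINT x|M. \<bar>approx n g x - g x\<bar> + \<bar>approx n h x - h x\<bar>)" for n
    proof (rule integral_mono)
      show "integrable M (\<lambda>x. \<bar>approx n (\<lambda>x. g x + h x) x - (g x + h x)\<bar>)"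
        using add.hyps by (intro integrable_abs_diff integrable_approx Bochner_Integration.integrable_add)
      show "\<bar>approx n (\<lambda>x. g x + h x) x - (g x + h x)\<bar> \<le> \<bar>approx n g x - g x\<bar> + \<bar>approx n h x - h x\<bar>" for x
        using approx_add[OF add.hyps, of n x] by linarith
    qed (use i in auto)
    then show "\<forall>\<^sub>F n in sequentially. (LINT x|M. \<bar>approx n (\<lambda>x. g x + h x) x - (g x + h x)\<bar>)
        \<le> (LINT x|M. \<bar>approx n g x - g x\<bar>) + (LINT x|M. \<bar>approx n h x - h x\<bar>)"
      using i by (simp add: Bochner_Integration.integral_add)
    show "(\<lambda>n. (LINT x|M. \<bar>approx n g x - g x\<bar>) + (LINT x|M. \<bar>approx n h x - h x\<bar>)) \<longlonglongrightarrow> 0"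
      using tendsto_add[OF add.IH] by simp
  qed (auto intro!: always_eventually integral_nonneg_AE)
next
  case (scale g c)
  have "(\<lambda>n. \<bar>c\<bar> * (LINT x|M. \<bar>approx n g x - g x\<bar>)) \<longlonglongrightarrow> \<bar>c\<bar> * 0"
    by (intro tendsto_intros scale)
  moreover have "\<bar>approx n (\<lambda>x. c * g x) x - c * g x\<bar> = \<bar>c\<bar> * \<bar>approx n g x - g x\<bar>" for n x
    by (simp add: approx_scale abs_mult flip: right_diff_distrib)
  ultimately show ?case by simp
next
  case (lim s g)
  let ?E = "\<lambda>n f. LINT x|M. \<bar>approx n f x - f x\<bar>"
  have tri: "?E n g \<le> (K + 1) * (LINT x|M. \<bar>s m x - g x\<bar>) + ?E n (s m)" for n m
  proof -
    have i: "integrable M (\<lambda>x. \<bar>approx n (\<lambda>x. s m x - g x) x\<bar>)" "integrable M (\<lambda>x. \<bar>s m x - g x\<bar>)"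
      "integrable M (\<lambda>x. \<bar>approx n (s m) x - s m x\<bar>)" "integrable M (\<lambda>x. \<bar>approx n g x - g x\<bar>)"
      by (rule integrable_abs integrable_abs_diff, (rule integrable_approx lim.hyps)+)+
    have "?E n g \<le> (LINT x|M. (\<bar>approx n (\<lambda>x. s m x - g x) x\<bar> + \<bar>s m x - g x\<bar>) + \<bar>approx n (s m) x - s m x\<bar>)"
    proof (rule integral_mono)
      show "\<bar>approx n g x - g x\<bar> \<le> (\<bar>approx n (\<lambda>x. s m x - g x) x\<bar> + \<bar>s m x - g x\<bar>) + \<bar>approx n (s m) x - s m x\<bar>" for x
        using approx_diff[OF lim.hyps(1,2), of n m x] by linarith
    qed (use i in auto)
    also have "\<dots> = (LINT x|M. \<bar>approx n (\<lambda>x. s m x - g x) x\<bar>) + (LINT x|M. \<bar>s m x - g x\<bar>) + ?E n (s m)"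
      using i by (simp add: Bochner_Integration.integral_add)
    also have "(LINT x|M. \<bar>approx n (\<lambda>x. s m x - g x) x\<bar>) \<le> K * (LINT x|M. \<bar>s m x - g x\<bar>)"
      using lim by (intro L1_approx_le Bochner_Integration.integrable_diff)
    finally show ?thesis by (simp add: distrib_right)
  qed
  show ?case
  proof (rule LIMSEQ_I)
    fix e :: real assume e: "e > 0"
    have "(\<lambda>m. (K + 1) * (LINT x|M. \<bar>s m x - g x\<bar>)) \<longlonglongrightarrow> (K + 1) * 0"
      by (intro tendsto_intros lim)
    then have "\<forall>\<^sub>F m in sequentially. (K + 1) * (LINT x|M. \<bar>s m x - g x\<bar>) < e / 2"
      by (rule order_tendstoD) (use e in simp)
    then obtain m where m: "(K + 1) * (LINT x|M. \<bar>s m x - g x\<bar>) < e / 2"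
      by (auto simp: eventually_sequentially)
    have "\<forall>\<^sub>F n in sequentially. ?E n (s m) < e / 2"
      by (rule order_tendstoD(2)[OF lim.IH]) (use e in simp)
    then obtain N where N: "\<And>n. n \<ge> N \<Longrightarrow> ?E n (s m) < e / 2"
      by (auto simp: eventually_sequentially)
    have "norm (?E n g - 0) < e" if "n \<ge> N" for n
    proof -
      have "?E n g \<ge> 0" by (intro integral_nonneg_AE) auto
      then show ?thesis using tri[of n m] m N[OF that] by simp
    qed
    then show "\<exists>N. \<forall>n\<ge>N. norm (?E n g - 0) < e" by blast
  qed
qed

text \<open>
  These pairs are the edges between two consecutive levels of a filling.
\<close>

definition meeting :: "nat \<Rightarrow> ('z set \<times> 'z set) set" where
  "meeting n = {(B, B'). B \<in> V (Suc n) \<and> B' \<in> V n \<and> B \<inter> B' \<noteq> {}}"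

lemma finite_meeting: "finite (meeting n)"
  by (rule finite_subset[of _ "V (Suc n) \<times> V n"]) (auto simp: meeting_def finite_V)

lemma card_meeting: "real (card (meeting n)) \<le> K\<^sup>2 * q ^ Suc n"
proof -
  have "meeting n = (SIGMA B:V (Suc n). {B' \<in> V n. B \<inter> B' \<noteq> {}})"
    by (auto simp: meeting_def)
  then have "real (card (meeting n)) = (\<Sum>B\<in>V (Suc n). real (card {B' \<in> V n. B \<inter> B' \<noteq> {}}))"
    by (simp add: finite_V)
  also have "\<dots> \<le> (\<Sum>B\<in>V (Suc n). K)"
    by (intro sum_mono V_neighbours)
  also have "\<dots> \<le> (K * q ^ Suc n) * K"
    using V_card[of "Suc n"] K_ge_1 by (simp add: mult_right_mono)
  finally show ?thesis by (simp add: power2_eq_square mult_ac)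
qed

text \<open>
  At a point the two approximations are means of the averages over the sets containing it, so
  their difference is a mean of differences, over pairs of sets that share the point and hence
  meet. Integrating, such a pair contributes with the measure of its intersection.
\<close>

lemma approx_step:
  "(LINT x|M. \<bar>approx (Suc n) f x - approx n f x\<bar>)
     \<le> K / q ^ Suc n * (\<Sum>(B, B')\<in>meeting n. \<bar>avg f B - avg f B'\<bar>)"
proof -
  have pt: "\<bar>approx (Suc n) f x - approx n f x\<bar>
      \<le> (\<Sum>P\<in>meeting n. indicat_real (fst P \<inter> snd P) x * \<bar>avg f (fst P) - avg f (snd P)\<bar>)" for x
  proof -
    let ?m = "overlap_count (Suc n) x * overlap_count n x"
    have pos: "overlap_count (Suc n) x \<ge> 1" "overlap_count n x \<ge> 1" by (rule overlap_count_ge_1)+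
    have m1: "?m \<ge> 1" using mult_mono[OF pos] pos by simp
    have "approx (Suc n) f x - approx n f x
        = ((\<Sum>B\<in>V (Suc n). indicat_real B x * avg f B) * overlap_count n x
           - overlap_count (Suc n) x * (\<Sum>B'\<in>V n. indicat_real B' x * avg f B')) / ?m"
      using pos unfolding approx_def by (simp add: field_simps)
    also have "\<dots> = (\<Sum>B\<in>V (Suc n). \<Sum>B'\<in>V n. indicat_real B x * indicat_real B' x * (avg f B - avg f B')) / ?m"
      unfolding overlap_count_eq sum_product sum_subtractf[symmetric]
      by (intro arg_cong2[where f="(/)"] refl sum.cong) (simp add: algebra_simps)
    also have "\<dots> = (\<Sum>P\<in>V (Suc n) \<times> V n. indicat_real (fst P \<inter> snd P) x * (avg f (fst P) - avg f (snd P))) / ?m"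
      by (simp add: sum.cartesian_product case_prod_unfold indicator_inter_arith)
    also have "\<dots> = (\<Sum>P\<in>meeting n. indicat_real (fst P \<inter> snd P) x * (avg f (fst P) - avg f (snd P))) / ?m"
      by (intro arg_cong2[where f="(/)"] refl sum.mono_neutral_right)
         (auto simp: finite_V meeting_def)
    finally have "\<bar>approx (Suc n) f x - approx n f x\<bar>
      = \<bar>\<Sum>P\<in>meeting n. indicat_real (fst P \<inter> snd P) x * (avg f (fst P) - avg f (snd P))\<bar> / ?m"
      using m1 by (simp add: abs_divide)
    also have "\<dots> \<le> \<bar>\<Sum>P\<in>meeting n. indicat_real (fst P \<inter> snd P) x * (avg f (fst P) - avg f (snd P))\<bar> / 1"
      using m1 by (intro divide_left_mono) auto
    also have "\<dots> \<le> (\<Sum>P\<in>meeting n. \<bar>indicat_real (fst P \<inter> snd P) x * (avg f (fst P) - avg f (snd P))\<bar>)"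
      by simp
    finally show ?thesis by (simp add: abs_mult)
  qed
  have borel: "fst P \<in> sets borel" "snd P \<in> sets borel" if "P \<in> meeting n" for P
    using that V_borel by (auto simp: meeting_def)
  have "(LINT x|M. \<bar>approx (Suc n) f x - approx n f x\<bar>)
      \<le> (LINT x|M. (\<Sum>P\<in>meeting n. indicat_real (fst P \<inter> snd P) x * \<bar>avg f (fst P) - avg f (snd P)\<bar>))"
    by (intro integral_mono integrable_ind_sum finite_meeting pt integrable_abs
        Bochner_Integration.integrable_diff integrable_approx sets.Int borel)
  also have "\<dots> = (\<Sum>P\<in>meeting n. measure M (fst P \<inter> snd P) * \<bar>avg f (fst P) - avg f (snd P)\<bar>)"
    by (subst Bochner_Integration.integral_sum)
       (auto intro!: integrable_ind sets.Int borel simp: space_UNIV)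
  also have "\<dots> \<le> (\<Sum>P\<in>meeting n. K / q ^ Suc n * \<bar>avg f (fst P) - avg f (snd P)\<bar>)"
  proof (intro sum_mono mult_right_mono)
    fix P assume P: "P \<in> meeting n"
    have "measure M (fst P \<inter> snd P) \<le> measure M (fst P)"
      using borel[OF P] by (intro finite_measure_mono) auto
    also have "\<dots> \<le> K / q ^ Suc n"
      using P by (intro V_measure) (auto simp: meeting_def)
    finally show "measure M (fst P \<inter> snd P) \<le> K / q ^ Suc n" .
  qed auto
  also have "\<dots> = K / q ^ Suc n * (\<Sum>(B, B')\<in>meeting n. \<bar>avg f B - avg f B'\<bar>)"
    by (simp add: sum_distrib_left case_prod_unfold)
  finally show ?thesis .
qed

text \<open>
  The bound of the first step in the proof below, times the sum of the geometric series of ratio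
  \<open>q powr (- 1/p)\<close>.
\<close>

definition poincare_const :: "real \<Rightarrow> real" where
  "poincare_const p = K * (K\<^sup>2) powr (1 - 1/p) / (1 - q powr (- 1 / p))"

text \<open>
  Telescoping from level 0, where the approximation is the mean of \<open>f\<close> over the space, to the
  limit \<open>f\<close>. Step \<open>n\<close> costs, up to constants, \<open>q powr (- n)\<close> times the sum of the differences, and
  the assumed bound of that sum over at most \<open>K\<^sup>2 q ^ (n + 1)\<close> pairs leaves \<open>q powr (- n / p)\<close>.
\<close>

theorem poincare_inequality:
  assumes f: "integrable M f" and p: "p > 1" and W: "W \<ge> 0"
    and bd: "\<And>n. (\<Sum>(B, B')\<in>meeting n. \<bar>avg f B - avg f B'\<bar>) \<le> W * real (card (meeting n)) powr (1 - 1/p)"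
  shows "(LINT x|M. \<bar>f x - avg f UNIV\<bar>) \<le> poincare_const p * W"
proof -
  define r where "r = q powr (- 1 / p)"
  have r: "0 < r" "r < 1" using q_gt_1 p by (auto simp: r_def intro!: powr_less_one)
  define C where "C = K * (K\<^sup>2) powr (1 - 1/p)"
  have C: "C \<ge> 0" using K_ge_1 by (simp add: C_def)
  have step: "(LINT x|M. \<bar>approx (Suc n) f x - approx n f x\<bar>) \<le> C * W * r ^ n" for n
  proof -
    have qn: "q ^ Suc n > 0" using q_gt_1 by simp
    have "(LINT x|M. \<bar>approx (Suc n) f x - approx n f x\<bar>)
      \<le> K / q ^ Suc n * (W * real (card (meeting n)) powr (1 - 1/p))"
      using K_ge_1 qn by (intro order_trans[OF approx_step] mult_left_mono bd) auto
    also have "\<dots> \<le> K / q ^ Suc n * (W * (K\<^sup>2 * q ^ Suc n) powr (1 - 1/p))"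
      using K_ge_1 qn W p card_meeting by (intro mult_left_mono powr_mono2) auto
    also have "\<dots> = C * W * ((q ^ Suc n) powr (1 - 1/p) / q ^ Suc n)"
      using qn by (simp add: powr_mult C_def)
    also have "(q ^ Suc n) powr (1 - 1/p) / q ^ Suc n = r ^ Suc n"
    proof -
      have "(q ^ Suc n) powr (1 - 1/p) / q ^ Suc n = (q ^ Suc n) powr (- 1/p)"
        using qn by (simp add: powr_diff powr_minus_divide)
      also have "\<dots> = r ^ Suc n"
        using q_gt_1 by (simp add: r_def powr_powr powr_realpow[symmetric] mult.commute del: power_Suc)
      finally show ?thesis .
    qed
    also have "C * W * r ^ Suc n \<le> C * W * r ^ n"
      using C W r by (intro mult_left_mono power_decreasing) auto
    finally show ?thesis .
  qed
  have tele: "(LINT x|M. \<bar>approx n f x - approx 0 f x\<bar>) \<le> (\<Sum>i<n. C * W * r ^ i)" for n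
  proof (induction n)
    case (Suc n)
    have "(LINT x|M. \<bar>approx (Suc n) f x - approx 0 f x\<bar>)
      \<le> (LINT x|M. \<bar>approx (Suc n) f x - approx n f x\<bar> + \<bar>approx n f x - approx 0 f x\<bar>)"
      by (intro integral_mono Bochner_Integration.integrable_add integrable_abs
          Bochner_Integration.integrable_diff integrable_approx) linarith
    also have "\<dots> = (LINT x|M. \<bar>approx (Suc n) f x - approx n f x\<bar>) + (LINT x|M. \<bar>approx n f x - approx 0 f x\<bar>)"
      by (intro Bochner_Integration.integral_add integrable_abs
          Bochner_Integration.integrable_diff integrable_approx)
    finally show ?case using Suc step[of n] by simp
  qed simp
  have geo: "(\<Sum>i<n. C * W * r ^ i) \<le> poincare_const p * W" for n
  proof -
    have "(\<Sum>i<n. r ^ i) \<le> 1 / (1 - r)"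
      using r by (simp add: sum_gp_strict divide_right_mono)
    then have "C * W * (\<Sum>i<n. r ^ i) \<le> C * W * (1 / (1 - r))"
      using C W by (intro mult_left_mono) auto
    then show ?thesis unfolding sum_distrib_left[symmetric]
      by (simp add: poincare_const_def C_def r_def mult_ac)
  qed
  have approx0: "approx 0 f x = avg f UNIV" for x
    by (simp add: approx_def overlap_count_eq V_0)
  have "(LINT x|M. \<bar>f x - avg f UNIV\<bar>) \<le> (LINT x|M. \<bar>approx n f x - f x\<bar>) + poincare_const p * W" for n
  proof -
    have "(LINT x|M. \<bar>f x - avg f UNIV\<bar>)
      \<le> (LINT x|M. \<bar>approx n f x - f x\<bar> + \<bar>approx n f x - approx 0 f x\<bar>)"
    proof (rule integral_mono)
      show "\<bar>f x - avg f UNIV\<bar> \<le> \<bar>approx n f x - f x\<bar> + \<bar>approx n f x - approx 0 f x\<bar>" for x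
        unfolding approx0 by linarith
    qed (intro Bochner_Integration.integrable_add integrable_abs_diff integrable_approx f integrable_const)+
    also have "\<dots> = (LINT x|M. \<bar>approx n f x - f x\<bar>) + (LINT x|M. \<bar>approx n f x - approx 0 f x\<bar>)"
      using f by (intro Bochner_Integration.integral_add integrable_abs
          Bochner_Integration.integrable_diff integrable_approx)
    finally show ?thesis using tele[of n] geo[of n] by linarith
  qed
  moreover have "(\<lambda>n. (LINT x|M. \<bar>approx n f x - f x\<bar>) + poincare_const p * W) \<longlonglongrightarrow> 0 + poincare_const p * W"
    by (intro tendsto_intros approx_tendsto_L1 f)
  ultimately show ?thesis by (intro LIMSEQ_le_const[of _ "poincare_const p * W"]) auto
qed

end

section \<open>Hyperbolic fillings of Ahlfors regular spaces\<close>

text \<open>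
  A point at distance at least \<open>\<epsilon>\<close> from \<open>S\<close> could be added to \<open>S\<close>.
\<close>

lemma maximal_separated_set_covers:
  assumes S: "maximal_separated_set \<epsilon> S" and "\<epsilon> > 0"
  shows "\<exists>z\<in>S. dist x z < \<epsilon>"
proof (rule ccontr)
  assume "\<not> ?thesis"
  then have far: "\<epsilon> \<le> dist x z" if "z \<in> S" for z using that by force
  then have "separated_set \<epsilon> (insert x S)"
    using S by (auto simp: maximal_separated_set_def separated_set_def dist_commute)
  then have "x \<in> S" using S by (auto simp: maximal_separated_set_def)
  then show False using far[of x] \<open>\<epsilon> > 0\<close> by simp
qed

lemma ahlfors_regular_finite_measure:
  assumes "compact (UNIV :: 'z::metric_space set)" and "ahlfors_regular Q (\<mu> :: 'z measure)"
  shows "finite_measure \<mu>"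
proof
  from assms(2) obtain c where sets: "sets \<mu> = sets borel"
    and c: "\<And>z. emeasure \<mu> (ball z 1) \<le> ennreal (c * 1 powr Q)"
    unfolding ahlfors_regular_def by (metis less_numeral_extra(1) order_refl)
  have "(UNIV :: 'z set) \<subseteq> (\<Union>z. ball z 1)" by (intro subsetI UN_I[OF UNIV_I]) (rule centre_in_ball[THEN iffD2], simp)
  then obtain T where T: "finite T" "(UNIV :: 'z set) \<subseteq> (\<Union>z\<in>T. ball z 1)"
    by (rule compactE_image[OF assms(1), rotated]) auto
  have "emeasure \<mu> (space \<mu>) \<le> emeasure \<mu> (\<Union>z\<in>T. ball z 1)"
    using T sets by (intro emeasure_mono) auto
  also have "\<dots> \<le> (\<Sum>z\<in>T. emeasure \<mu> (ball z 1))"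
    using T sets by (intro emeasure_subadditive_finite) auto
  also have "\<dots> \<le> (\<Sum>z\<in>T. ennreal (c * 1 powr Q))" by (intro sum_mono c)
  also have "\<dots> < \<infinity>" by (simp add: ennreal_mult_less_top of_nat_less_top)
  finally show "emeasure \<mu> (space \<mu>) \<noteq> \<infinity>" by simp
qed

text \<open>
  Ahlfors regularity speaks of radii up to 1. The upper bound persists for larger radii when the
  constant is at least the total measure.
\<close>

lemma ahlfors_regular_measure_bounds:
  assumes "compact (UNIV :: 'z::metric_space set)" and reg: "ahlfors_regular Q (\<mu> :: 'z measure)" and Q: "Q > 0"
  obtains c where "c \<ge> 1" "\<And>z r. r > 0 \<Longrightarrow> measure \<mu> (ball z r) \<le> c * r powr Q"
    "\<And>z r. \<lbrakk>0 < r; r \<le> 1\<rbrakk> \<Longrightarrow> r powr Q / c \<le> measure \<mu> (ball z r)"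
    "measure \<mu> UNIV \<le> c"
proof -
  interpret finite_measure \<mu> by (rule ahlfors_regular_finite_measure[OF assms(1,2)])
  from reg obtain c where sets: "sets \<mu> = sets borel" and c1: "c \<ge> 1"
    and c: "\<And>z r. 0 < r \<Longrightarrow> r \<le> 1 \<Longrightarrow> ennreal (r powr Q / c) \<le> emeasure \<mu> (ball z r) \<and>
        emeasure \<mu> (ball z r) \<le> ennreal (c * r powr Q)"
    unfolding ahlfors_regular_def by blast
  have space: "space \<mu> = UNIV" using sets_eq_imp_space_eq[OF sets] by simp
  define c' where "c' = max c (measure \<mu> UNIV)"
  have c': "c' \<ge> 1" "c \<le> c'" using c1 by (auto simp: c'_def)
  show ?thesis
  proof (rule that[of c'])
    fix z r assume r: "0 < (r::real)"
    show "measure \<mu> (ball z r) \<le> c' * r powr Q"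
    proof (cases "r \<le> 1")
      case True
      then have "measure \<mu> (ball z r) \<le> c * r powr Q"
        using c[OF r True, of z] c1 r by (simp add: emeasure_eq_measure ennreal_le_iff)
      also have "\<dots> \<le> c' * r powr Q" using c' by (intro mult_right_mono) auto
      finally show ?thesis .
    next
      case False
      have "measure \<mu> (ball z r) \<le> measure \<mu> UNIV"
        using bounded_measure[of "ball z r"] space by simp
      also have "\<dots> \<le> c' * 1" by (simp add: c'_def)
      also have "\<dots> \<le> c' * r powr Q" using False Q c' by (intro mult_left_mono ge_one_powr_ge_zero) auto
      finally show ?thesis .
    qed
    show "r powr Q / c' \<le> measure \<mu> (ball z r)" if "r \<le> 1"
    proof -
      have "r powr Q / c' \<le> r powr Q / c" using c' c1 by (intro divide_left_mono) auto
      also have "\<dots> \<le> measure \<mu> (ball z r)"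
        using c[OF r that, of z] c1 by (simp add: emeasure_eq_measure ennreal_le_iff)
      finally show ?thesis .
    qed
  qed (use c' in \<open>auto simp: c'_def\<close>)
qed

text \<open>
  The volume argument behind all counts in the filling: the balls of radius \<open>\<epsilon> / 2\<close> about the
  points of \<open>F\<close> are disjoint and lie in one ball of radius \<open>(R + 1/2) \<epsilon>\<close>, whose measure is at most
  a constant multiple of each of theirs.
\<close>

lemma separated_set_card_le:
  fixes \<mu> :: "'z::metric_space measure"
  assumes fin: "finite_measure \<mu>" and sets: "sets \<mu> = sets borel" and c: "c \<ge> 1" and Q: "Q > 0"
    and upper: "\<And>z r. r > 0 \<Longrightarrow> measure \<mu> (ball z r) \<le> c * r powr Q"
    and lower: "\<And>z r. \<lbrakk>0 < r; r \<le> 1\<rbrakk> \<Longrightarrow> r powr Q / c \<le> measure \<mu> (ball z r)"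
    and \<epsilon>: "0 < \<epsilon>" "\<epsilon> \<le> 1" and S: "separated_set \<epsilon> (S :: 'z set)" and R: "R \<ge> 0"
    and F: "F \<subseteq> S" "F \<subseteq> ball x (R * \<epsilon>)"
  shows "finite F \<and> real (card F) \<le> c\<^sup>2 * (2 * R + 1) powr Q"
proof -
  interpret finite_measure \<mu> by fact
  have bd: "real (card G) \<le> c\<^sup>2 * (2 * R + 1) powr Q" if G: "G \<subseteq> F" "finite G" for G
  proof -
    have "disjoint_family_on (\<lambda>z. ball z (\<epsilon> / 2)) G"
      unfolding disjoint_family_on_def
    proof (intro ballI impI)
      fix y z assume yz: "y \<in> G" "z \<in> G" "y \<noteq> z"
      then have "\<epsilon> \<le> dist y z" using S F G unfolding separated_set_def by blast
      then show "ball y (\<epsilon> / 2) \<inter> ball z (\<epsilon> / 2) = {}"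
        using disjoint_ballI[of "\<epsilon> / 2" "\<epsilon> / 2" y z] by simp
    qed
    then have sum: "(\<Sum>z\<in>G. measure \<mu> (ball z (\<epsilon> / 2))) = measure \<mu> (\<Union>z\<in>G. ball z (\<epsilon> / 2))"
      using G sets by (intro finite_measure_finite_Union[symmetric]) auto
    have "real (card G) * ((\<epsilon> / 2) powr Q / c) = (\<Sum>z\<in>G. (\<epsilon> / 2) powr Q / c)" by simp
    also have "\<dots> \<le> (\<Sum>z\<in>G. measure \<mu> (ball z (\<epsilon> / 2)))"
      using \<epsilon> by (intro sum_mono lower) auto
    also have "\<dots> \<le> measure \<mu> (ball x ((2 * R + 1) * (\<epsilon> / 2)))"
      unfolding sum
    proof (rule finite_measure_mono)
      show "(\<Union>z\<in>G. ball z (\<epsilon> / 2)) \<subseteq> ball x ((2 * R + 1) * (\<epsilon> / 2))"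
      proof
        fix y assume "y \<in> (\<Union>z\<in>G. ball z (\<epsilon> / 2))"
        then obtain z where z: "z \<in> G" "dist z y < \<epsilon> / 2" by auto
        then have "dist x z < R * \<epsilon>" using F G by (auto simp: subset_iff)
        then have "dist x y < R * \<epsilon> + \<epsilon> / 2" using z dist_triangle[of x y z] by linarith
        then show "y \<in> ball x ((2 * R + 1) * (\<epsilon> / 2))" by (simp add: algebra_simps)
      qed
    qed (use sets in simp)
    also have "\<dots> \<le> c * ((2 * R + 1) * (\<epsilon> / 2)) powr Q"
      using \<epsilon> R by (intro upper) simp
    also have "\<dots> = c * (2 * R + 1) powr Q * (\<epsilon> / 2) powr Q"
      using \<epsilon> R by (subst powr_mult) auto
    finally have "(real (card G) / c) * (\<epsilon> / 2) powr Q \<le> (c * (2 * R + 1) powr Q) * (\<epsilon> / 2) powr Q"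
      by simp
    then have "real (card G) / c \<le> c * (2 * R + 1) powr Q"
      by (rule mult_right_le_imp_le) (use \<epsilon> in simp)
    then show ?thesis using c by (simp add: field_simps power2_eq_square)
  qed
  have "finite F \<and> card F \<le> nat \<lfloor>c\<^sup>2 * (2 * R + 1) powr Q\<rfloor>"
    by (rule finite_if_finite_subsets_card_bdd) (use bd in \<open>auto simp: le_nat_floor\<close>)
  then show ?thesis using bd by blast
qed

lemma level_radius: "(2::real) powr (1 - real n) = 2 / 2 ^ n"
  by (simp add: powr_diff powr_realpow)

text \<open>
  At level \<open>n\<close> the centres are \<open>1 / 2 ^ n\<close>-separated and the balls have radius \<open>2 / 2 ^ n\<close>. In the
  counting lemma, \<open>R = 2\<close> counts the balls containing a point, \<open>R = 3\<close> those meeting a ball of the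
  next level, and \<open>R = 2 * 2 ^ n\<close> all balls of the level. Different centres may give the same ball,
  so the numbers of centres are only upper bounds for the numbers of balls.
\<close>

theorem hyperbolic_filling_bounded_overlap:
  fixes \<mu> :: "'z::metric_space measure"
  assumes Q: "Q > 0" and cpt: "compact (UNIV :: 'z set)" and diam: "diameter (UNIV :: 'z set) = 1"
    and reg: "ahlfors_regular Q \<mu>"
    and Zs: "\<And>n. n \<ge> 1 \<Longrightarrow> maximal_separated_set (2 powr (- real n)) (Zs n)"
  obtains K where "bounded_overlap_covers \<mu> (level_balls Zs) K (2 powr Q)"
proof -
  have fin: "finite_measure \<mu>" by (rule ahlfors_regular_finite_measure[OF cpt reg])
  interpret finite_measure \<mu> by fact
  obtain c where c: "c \<ge> 1" and upper: "\<And>z r. r > 0 \<Longrightarrow> measure \<mu> (ball z r) \<le> c * r powr Q"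
    and lower: "\<And>z r. \<lbrakk>0 < r; r \<le> 1\<rbrakk> \<Longrightarrow> r powr Q / c \<le> measure \<mu> (ball z r)"
    and total: "measure \<mu> UNIV \<le> c"
    using ahlfors_regular_measure_bounds[OF cpt reg Q] by metis
  have sets: "sets \<mu> = sets borel" using reg by (simp add: ahlfors_regular_def)
  have space: "space \<mu> = UNIV" using sets_eq_imp_space_eq[OF sets] by simp
  have dist1: "dist x y \<le> 1" for x y :: 'z
    using diameter_bounded_bound[OF compact_imp_bounded[OF cpt], of x y] diam by simp
  have Z: "maximal_separated_set (1 / 2 ^ n) (Zs n)" if "n \<ge> 1" for n
    using Zs[OF that] by (simp add: powr_minus_divide powr_realpow)
  \<comment> \<open>The base 7 is \<open>2 * R + 1\<close> for \<open>R = 3\<close>; it also gives \<open>2 * (2 * 2 ^ n) + 1 \<le> 7 * 2 ^ n\<close>.\<close>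
  define K where "K = c\<^sup>2 * 7 powr Q"
  have "c * 1 \<le> c\<^sup>2 * 7 powr Q"
    unfolding power2_eq_square mult.assoc using c Q mult_mono[of 1 c 1 "7 powr Q"]
    by (intro mult_left_mono) (auto simp: ge_one_powr_ge_zero)
  then have K1: "1 \<le> K" "c \<le> K" using c by (auto simp: K_def)
  have V_0: "level_balls Zs 0 = {UNIV}" by (simp add: level_balls_def)
  have V: "level_balls Zs n = (\<lambda>z. ball z (2 / 2 ^ n)) ` Zs n" if "n \<ge> 1" for n
    using that by (simp add: level_balls_def level_radius)
  have count: "finite F \<and> real (card F) \<le> c\<^sup>2 * (2 * R + 1) powr Q"
    if "n \<ge> 1" "R \<ge> 0" "F \<subseteq> Zs n" "\<And>z. z \<in> F \<Longrightarrow> dist x z < R / 2 ^ n" for n R F x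
    using that Z[OF that(1)]
    by (intro separated_set_card_le[OF fin sets c Q upper lower, of "1 / 2 ^ n" "Zs n" R F x])
       (auto simp: maximal_separated_set_def)
  have count_le_K: "real (card ((\<lambda>z. ball z (2 / 2 ^ n)) ` F)) \<le> K"
    if "n \<ge> 1" "R \<ge> 0" "R \<le> 3" "F \<subseteq> Zs n" "\<And>z. z \<in> F \<Longrightarrow> dist x z < R / 2 ^ n" for n R F x
  proof -
    have F: "finite F" "real (card F) \<le> c\<^sup>2 * (2 * R + 1) powr Q" using count[of n R F x] that by auto
    have "real (card ((\<lambda>z. ball z (2 / 2 ^ n)) ` F)) \<le> real (card F)"
      using card_image_le[OF F(1)] by simp
    also have "\<dots> \<le> c\<^sup>2 * (2 * R + 1) powr Q" by (rule F)
    also have "\<dots> \<le> K" unfolding K_def using that Q by (intro mult_left_mono powr_mono2) auto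
    finally show ?thesis .
  qed
  have Zs_count: "finite (Zs n) \<and> real (card (Zs n)) \<le> K * (2 powr Q) ^ n" if n: "n \<ge> 1" for n
  proof -
    have "finite (Zs n) \<and> real (card (Zs n)) \<le> c\<^sup>2 * (2 * (2 * 2 ^ n) + 1) powr Q"
    proof (rule count[OF n])
      show "dist undefined z < 2 * 2 ^ n / 2 ^ n" for z :: 'z
        using dist1[of undefined z] by simp
    qed auto
    moreover have "1 \<le> (2::real) ^ n" by simp
    then have "2 * (2 * 2 ^ n) + 1 \<le> 7 * (2::real) ^ n" by linarith
    then have "c\<^sup>2 * (2 * (2 * 2 ^ n) + 1) powr Q \<le> c\<^sup>2 * (7 * 2 ^ n) powr Q"
      using Q by (intro mult_left_mono powr_mono2) auto
    moreover have "(7 * 2 ^ n) powr Q = 7 powr Q * (2 powr Q) ^ n"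
      by (simp add: powr_mult powr_powr mult.commute flip: powr_realpow)
    ultimately show ?thesis unfolding K_def by (auto simp: mult.assoc)
  qed
  have "bounded_overlap_covers \<mu> (level_balls Zs) K (2 powr Q)"
  proof (intro bounded_overlap_covers.intro bounded_overlap_covers_axioms.intro fin sets)
    show "2 powr Q > 1" using Q by simp
    show "level_balls Zs 0 = {UNIV}" by (rule V_0)
    fix n
    show "finite (level_balls Zs n)"
      using Zs_count[of n] V[of n] V_0 by (cases "n = 0") auto
    show "real (card (level_balls Zs n)) \<le> K * (2 powr Q) ^ n"
    proof (cases "n = 0")
      case False
      then show ?thesis
        using Zs_count[of n] V[of n] card_image_le[of "Zs n" "\<lambda>z. ball z (2 / 2 ^ n)"] by simp
    qed (use V_0 K1 in simp)
    fix x :: 'z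
    show "\<exists>B\<in>level_balls Zs n. x \<in> B"
    proof (cases "n = 0")
      case False
      then obtain z where "z \<in> Zs n" "dist x z < 1 / 2 ^ n"
        using maximal_separated_set_covers[OF Z[of n], of x] by auto
      then have "z \<in> Zs n" "x \<in> ball z (2 / 2 ^ n)"
        by (auto simp: dist_commute field_simps intro: less_trans)
      then show ?thesis using V[of n] False by auto
    qed (use V_0 in simp)
    show "real (card {B \<in> level_balls Zs n. x \<in> B}) \<le> K"
    proof (cases "n = 0")
      case False
      then have n: "n \<ge> 1" by simp
      have eq: "{B \<in> level_balls Zs n. x \<in> B}
          = (\<lambda>z. ball z (2 / 2 ^ n)) ` {z \<in> Zs n. dist x z < 2 / 2 ^ n}"
        unfolding V[OF n] image_def mem_ball[symmetric] by (auto simp: dist_commute)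
      show ?thesis unfolding eq using n by (intro count_le_K[of n 2 _ x]) auto
    next
      case True
      have "{B \<in> {UNIV}. x \<in> B} = {UNIV}" by auto
      then show ?thesis using True V_0 K1 by simp
    qed
  next
    fix B n assume B: "B \<in> level_balls Zs n"
    have cases: "(n = 0 \<and> B = UNIV) \<or> (n \<ge> 1 \<and> (\<exists>z\<in>Zs n. B = ball z (2 / 2 ^ n)))"
      using B V[of n] V_0 by (cases "n = 0") auto
    show "B \<in> sets borel" using cases by auto
    have le1: "2 / 2 ^ n \<le> (1::real)" if "n \<ge> 1"
      using power_increasing[OF that, of "2::real"] by simp
    have small: "measure \<mu> (ball z 1) > 0" for z
    proof -
      have "0 < 1 powr Q / c" using c by simp
      also have "\<dots> \<le> measure \<mu> (ball z 1)" by (rule lower) auto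
      finally show ?thesis .
    qed
    show "0 < measure \<mu> B"
      using cases
    proof (elim disjE conjE bexE)
      fix z assume "n \<ge> 1" "B = ball z (2 / 2 ^ n)"
      moreover have "0 < (2 / 2 ^ n) powr Q / c" using c by simp
      ultimately show ?thesis using lower[of "2 / 2 ^ n" z] le1 by simp
    next
      assume "B = UNIV"
      then show ?thesis
        using small[of undefined] finite_measure_mono[of "ball undefined 1" UNIV] sets by simp
    qed
    show "measure \<mu> B \<le> K / (2 powr Q) ^ n"
      using cases
    proof (elim disjE conjE bexE)
      fix z assume "B = ball z (2 / 2 ^ n)"
      then have "measure \<mu> B \<le> c * (2 / 2 ^ n) powr Q" using upper[of "2 / 2 ^ n" z] by simp
      also have "\<dots> = c * 2 powr Q / (2 powr Q) ^ n"
        by (simp add: powr_divide powr_powr mult.commute flip: powr_realpow)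
      also have "c * 2 powr Q \<le> K"
        unfolding K_def power2_eq_square
        using c Q mult_left_mono[of 1 c c] by (intro mult_mono powr_mono2) auto
      finally show ?thesis by (simp add: divide_right_mono)
    next
      assume "n = 0" "B = UNIV"
      then show ?thesis using total K1 by simp
    qed
    fix x y assume xy: "x \<in> B" "y \<in> B"
    show "dist x y \<le> 4 / 2 ^ n"
      using cases
    proof (elim disjE conjE bexE)
      fix z assume "B = ball z (2 / 2 ^ n)"
      then show ?thesis using xy dist_triangle3[of x y z] by simp
    next
      assume "n = 0"
      then show ?thesis using dist1[of x y] by simp
    qed
  next
    fix B n assume B: "B \<in> level_balls Zs (Suc n)"
    show "real (card {B' \<in> level_balls Zs n. B \<inter> B' \<noteq> {}}) \<le> K"
    proof (cases "n = 0")
      case False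
      obtain z where z: "B = ball z (1 / 2 ^ n)" using B V[of "Suc n"] by auto
      let ?F = "{z' \<in> Zs n. B \<inter> ball z' (2 / 2 ^ n) \<noteq> {}}"
      have eq: "{B' \<in> level_balls Zs n. B \<inter> B' \<noteq> {}} = (\<lambda>z. ball z (2 / 2 ^ n)) ` ?F"
        using V[of n] False by auto
      have "dist z z' < 3 / 2 ^ n" if z': "z' \<in> ?F" for z'
      proof -
        obtain y where "dist z y < 1 / 2 ^ n" "dist z' y < 2 / 2 ^ n" using z' z by auto
        then have "dist z z' < 1 / 2 ^ n + 2 / 2 ^ n" using dist_triangle2[of z z' y] by linarith
        then show ?thesis by (simp flip: add_divide_distrib)
      qed
      then show ?thesis unfolding eq using False by (intro count_le_K[of n 3 ?F z]) auto
    next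
      case True
      have "card {B' \<in> level_balls Zs n. B \<inter> B' \<noteq> {}} \<le> card {UNIV :: 'z set}"
        using True V_0 by (intro card_mono) auto
      then show ?thesis using K1 by simp
    qed
  qed
  then show ?thesis by (rule that)
qed

section \<open>The gradient of the Poisson extension\<close>

locale filling_averages = bounded_overlap_covers \<mu> "level_balls Zs" K q
  for \<mu> :: "'z::metric_space measure" and Zs K q +
  fixes ini ter :: "'z edge \<Rightarrow> 'z vertex" and p :: real
  assumes orientation: "e \<in> edges Zs \<Longrightarrow> e = {ini e, ter e}"
    and p_gt_1: "p > 1"
begin

abbreviation grad :: "('z \<Rightarrow> real) \<Rightarrow> 'z edge \<Rightarrow> real" where
  "grad f \<equiv> gradient (edges Zs) ini ter (poisson \<mu> f)"

abbreviation wnorm :: "('z edge \<Rightarrow> real) \<Rightarrow> real" where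
  "wnorm \<equiv> weak_lp_norm p (edges Zs)"

lemma poisson_eq_avg: "poisson \<mu> f v = avg f (snd v)"
  by (simp add: poisson_def avg_def)

lemma endpoint_ball:
  assumes "e \<in> edges Zs"
  obtains m n where "snd (ini e) \<in> level_balls Zs m" "snd (ter e) \<in> level_balls Zs n"
proof -
  have "e \<subseteq> vertices Zs" using assms by (auto simp: edges_def)
  then have "ini e \<in> vertices Zs" "ter e \<in> vertices Zs" using orientation[OF assms] by auto
  then show ?thesis using that by (auto simp: vertices_def)
qed

lemma grad_at:
  "e \<in> edges Zs \<Longrightarrow> grad f e = avg f (snd (ter e)) - avg f (snd (ini e))"
  by (simp add: gradient_def poisson_eq_avg)

lemma grad_add:
  assumes "integrable \<mu> f" "integrable \<mu> g"
  shows "grad (\<lambda>x. f x + g x) = (\<lambda>e. grad f e + grad g e)"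
proof
  fix e
  show "grad (\<lambda>x. f x + g x) e = grad f e + grad g e"
  proof (cases "e \<in> edges Zs")
    case True
    then obtain m n where "snd (ini e) \<in> level_balls Zs m" "snd (ter e) \<in> level_balls Zs n"
      by (rule endpoint_ball)
    then show ?thesis using True assms by (simp add: grad_at avg_add V_borel)
  qed (simp add: gradient_def)
qed

lemma grad_scale: "grad (\<lambda>x. a * f x) = (\<lambda>e. a * grad f e)"
  by (auto simp: gradient_def poisson_eq_avg avg_scale right_diff_distrib)

lemma grad_diff:
  assumes "integrable \<mu> f" "integrable \<mu> g"
  shows "grad (\<lambda>x. f x - g x) = (\<lambda>e. grad f e - grad g e)"
proof -
  have "integrable \<mu> (\<lambda>x. -1 * g x)" using assms by simp
  from grad_add[OF assms(1) this] show ?thesis unfolding grad_scale by simp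
qed

lemma grad_AE_const:
  assumes f: "integrable \<mu> f" and c: "AE x in \<mu>. f x = c"
  shows "grad f = (\<lambda>_. 0)"
proof
  fix e
  have avg: "avg f B = c" if B: "B \<in> level_balls Zs n" for B n
  proof -
    have "(LINT x:B|\<mu>. f x) = (LINT x:B|\<mu>. c)"
      unfolding set_lebesgue_integral_def
    proof (rule integral_cong_AE)
      show "(\<lambda>x. indicat_real B x *\<^sub>R f x) \<in> borel_measurable \<mu>"
        "(\<lambda>x. indicat_real B x *\<^sub>R c) \<in> borel_measurable \<mu>"
        using integrable_on_borel[OF f V_borel[OF B]] integrable_on_borel[OF _ V_borel[OF B], of "\<lambda>_. c"]
        unfolding set_integrable_def by (blast intro: borel_measurable_integrable integrable_const)+
      show "AE x in \<mu>. indicat_real B x *\<^sub>R f x = indicat_real B x *\<^sub>R c"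
        using c by eventually_elim simp
    qed
    then show ?thesis using avg_const[OF B, of c] by (simp add: avg_def)
  qed
  show "grad f e = 0"
  proof (cases "e \<in> edges Zs")
    case True
    then obtain m n where "snd (ini e) \<in> level_balls Zs m" "snd (ter e) \<in> level_balls Zs n"
      by (rule endpoint_ball)
    then show ?thesis using True by (simp add: grad_at avg)
  qed (simp add: gradient_def)
qed

definition meeting_edge :: "nat \<Rightarrow> 'z set \<times> 'z set \<Rightarrow> 'z edge" where
  "meeting_edge n P = {(Suc n, fst P), (n, snd P)}"

lemma meeting_edge_in_edges:
  assumes "P \<in> meeting n"
  shows "meeting_edge n P \<in> edges Zs"
proof -
  have "fst P \<in> level_balls Zs (Suc n)" "snd P \<in> level_balls Zs n" "fst P \<inter> snd P \<noteq> {}"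
    using assms by (auto simp: meeting_def)
  then have "(Suc n, fst P) \<in> vertices Zs \<and> (n, snd P) \<in> vertices Zs \<and> (Suc n, fst P) \<noteq> (n, snd P) \<and>
      \<bar>int (fst (Suc n, fst P)) - int (fst (n, snd P))\<bar> \<le> 1 \<and> snd (Suc n, fst P) \<inter> snd (n, snd P) \<noteq> {}"
    by (simp add: vertices_def)
  then show ?thesis unfolding meeting_edge_def edges_def by blast
qed

text \<open>
  The levels tell the two endpoints apart, so a pair can be read off its edge.
\<close>

lemma inj_meeting_edge: "inj_on (meeting_edge n) A"
  by (rule inj_onI) (auto simp: meeting_edge_def doubleton_eq_iff prod_eq_iff)

lemma edges_nonempty: "edges Zs \<noteq> {}"
proof -
  obtain B where "B \<in> level_balls Zs 1" "undefined \<in> B" using V_covers by blast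
  then have "(B, UNIV) \<in> meeting 0" by (auto simp: meeting_def V_0)
  then show ?thesis using meeting_edge_in_edges by blast
qed

lemma abs_grad_meeting_edge:
  assumes "P \<in> meeting n"
  shows "\<bar>grad f (meeting_edge n P)\<bar> = \<bar>avg f (fst P) - avg f (snd P)\<bar>"
proof -
  let ?e = "meeting_edge n P"
  have e: "?e \<in> edges Zs" by (rule meeting_edge_in_edges[OF assms])
  have "{ini ?e, ter ?e} = {(Suc n, fst P), (n, snd P)}"
    using orientation[OF e] by (simp add: meeting_edge_def)
  then have "(ini ?e = (Suc n, fst P) \<and> ter ?e = (n, snd P)) \<or> (ini ?e = (n, snd P) \<and> ter ?e = (Suc n, fst P))"
    by (auto simp: doubleton_eq_iff)
  then show ?thesis using e by (auto simp: grad_at abs_minus_commute)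
qed

text \<open>
  The pairs of consecutive levels are finitely many distinct edges, and on each of them the
  gradient is, up to sign, the difference of the averages, whatever the orientation.
\<close>

lemma poincare_weak_lp:
  assumes f: "integrable \<mu> f" and w: "grad f \<in> weak_lp_set p (edges Zs)"
  shows "(LINT x|\<mu>. \<bar>f x - avg f UNIV\<bar>) \<le> poincare_const p * wnorm (grad f)"
proof (rule poincare_inequality[OF f p_gt_1])
  show "0 \<le> wnorm (grad f)" by (rule weak_lp_norm_nonneg[OF p_gt_1 w edges_nonempty])
  fix n
  have "(\<Sum>(B, B')\<in>meeting n. \<bar>avg f B - avg f B'\<bar>) = (\<Sum>P\<in>meeting n. \<bar>grad f (meeting_edge n P)\<bar>)"
    by (simp add: abs_grad_meeting_edge case_prod_unfold)
  also have "\<dots> = (\<Sum>e\<in>meeting_edge n ` meeting n. \<bar>grad f e\<bar>)"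
    by (simp add: sum.reindex[OF inj_meeting_edge])
  also have "\<dots> \<le> wnorm (grad f) * real (card (meeting_edge n ` meeting n)) powr (1 - 1/p)"
    by (rule weak_lp_boundD[OF weak_lp_norm_bound[OF p_gt_1 w]])
       (auto simp: meeting_edge_in_edges finite_meeting)
  finally show "(\<Sum>(B, B')\<in>meeting n. \<bar>avg f B - avg f B'\<bar>)
      \<le> wnorm (grad f) * real (card (meeting n)) powr (1 - 1/p)"
    by (simp add: card_image[OF inj_meeting_edge])
qed

lemma grad_eq_0_iff:
  assumes f: "integrable \<mu> f"
  shows "grad f = (\<lambda>_. 0) \<longleftrightarrow> (\<exists>c. AE x in \<mu>. f x = c)"
proof
  assume 0: "grad f = (\<lambda>_. 0)"
  have "wnorm (\<lambda>_. 0) \<le> 0"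
    by (intro weak_lp_norm_le edges_nonempty) (simp add: weak_lp_bound_def)
  then have "wnorm (grad f) = 0"
    using weak_lp_norm_nonneg[OF p_gt_1 weak_lp_set_zero[OF p_gt_1] edges_nonempty] 0 by simp
  then have le: "(LINT x|\<mu>. \<bar>f x - avg f UNIV\<bar>) \<le> 0"
    using poincare_weak_lp[OF f] weak_lp_set_zero[OF p_gt_1, of "edges Zs"] 0 by simp
  have int: "integrable \<mu> (\<lambda>x. \<bar>f x - avg f UNIV\<bar>)"
    by (intro integrable_abs_diff f integrable_const)
  have "(LINT x|\<mu>. \<bar>f x - avg f UNIV\<bar>) = 0"
    using le by (intro antisym integral_nonneg_AE) auto
  then have "AE x in \<mu>. \<bar>f x - avg f UNIV\<bar> = 0"
    using integral_nonneg_eq_0_iff_AE[OF int] by simp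
  then show "\<exists>c. AE x in \<mu>. f x = c" by (intro exI[of _ "avg f UNIV"]) simp
next
  assume "\<exists>c. AE x in \<mu>. f x = c"
  then show "grad f = (\<lambda>_. 0)" using grad_AE_const[OF f] by blast
qed

abbreviation Adot :: "(real, 'z \<Rightarrow> real) module" where
  "Adot \<equiv> A_dot \<mu> p (edges Zs) ini ter"

abbreviation W :: "(real, 'z edge \<Rightarrow> real) module" where
  "W \<equiv> weak_lp p (edges Zs)"

lemma carrier_Adot: "f \<in> carrier Adot \<longleftrightarrow> integrable \<mu> f \<and> grad f \<in> weak_lp_set p (edges Zs)"
  by (simp add: A_dot_def function_module_def)

lemma module_Adot: "module real_ring Adot"
  unfolding A_dot_def
proof (rule module_function_module)
  have "grad (\<lambda>_. 0) = (\<lambda>_. 0)" by (rule grad_AE_const[of _ 0]) auto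
  then show "(\<lambda>_. 0) \<in> {f. integrable \<mu> f \<and> grad f \<in> weak_lp_set p (edges Zs)}"
    by (simp add: weak_lp_set_zero p_gt_1)
qed (auto simp: grad_add grad_scale weak_lp_set_add weak_lp_set_smult p_gt_1)

lemma linear_map_grad: "linear_map Adot W grad"
  unfolding linear_map_def
  by (auto simp: carrier_Adot grad_add)
     (auto simp: A_dot_def function_module_def grad_add grad_scale)

lemma avg_tendsto:
  assumes g: "\<And>k. integrable \<mu> (g k)" "integrable \<mu> h"
    and lim: "(\<lambda>k. LINT x|\<mu>. \<bar>g k x - h x\<bar>) \<longlonglongrightarrow> 0" and B: "B \<in> level_balls Zs n"
  shows "(\<lambda>k. avg (g k) B) \<longlonglongrightarrow> avg h B"
proof (rule LIM_zero_cancel, rule Lim_null_comparison)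
  show "(\<lambda>k. (LINT x|\<mu>. \<bar>g k x - h x\<bar>) / measure \<mu> B) \<longlonglongrightarrow> 0"
    using tendsto_divide[OF lim tendsto_const, of "measure \<mu> B"] V_pos[OF B] by simp
  have "norm (avg (g k) B - avg h B) \<le> (LINT x|\<mu>. \<bar>g k x - h x\<bar>) / measure \<mu> B" for k
  proof -
    have i: "integrable \<mu> (\<lambda>x. \<bar>g k x - h x\<bar>)" by (intro integrable_abs_diff g)
    have "measure \<mu> B * \<bar>avg (\<lambda>x. g k x - h x) B\<bar> \<le> (LINT x:B|\<mu>. \<bar>g k x - h x\<bar>)"
      by (rule abs_avg_le[OF B])
    also have "\<dots> \<le> (LINT x|\<mu>. \<bar>g k x - h x\<bar>)"
      unfolding set_lebesgue_integral_def
      by (intro integral_mono integrable_on_borel[OF i V_borel[OF B], unfolded set_integrable_def] i)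
         (auto simp: indicator_def)
    finally show ?thesis
      using V_pos[OF B] by (simp add: avg_diff[OF g V_borel[OF B]] pos_le_divide_eq mult.commute)
  qed
  then show "\<forall>\<^sub>F k in sequentially. norm (avg (g k) B - avg h B) \<le> (LINT x|\<mu>. \<bar>g k x - h x\<bar>) / measure \<mu> B"
    by simp
qed

text \<open>
  Let the gradients of \<open>f k\<close> converge to \<open>l\<close>. Subtracting the mean values does not change the
  gradients, and by the Poincare inequality the resulting \<open>g k\<close> form a Cauchy sequence in \<open>L\<^sup>1\<close>.
  Averages over balls are continuous on \<open>L\<^sup>1\<close>, so the gradient of the limit is the pointwise
  limit of the gradients, that is \<open>l\<close>.
\<close>

lemma closedin_range_grad:
  "closedin (Metric_space.mtopology (carrier W) (norm_dist W wnorm)) (grad ` carrier Adot)"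
proof -
  interpret W: banach_module W wnorm by (rule banach_module_weak_lp[OF p_gt_1 edges_nonempty])
  show ?thesis
    unfolding W.metric_closedin_iff_sequentially_closed
  proof (intro conjI allI impI)
    show "grad ` carrier Adot \<subseteq> carrier W" by (auto simp: carrier_Adot)
    fix \<sigma> l assume "range \<sigma> \<subseteq> grad ` carrier Adot \<and> limitin W.mtopology \<sigma> l sequentially"
    then have ran: "range \<sigma> \<subseteq> grad ` carrier Adot" and lim: "limitin W.mtopology \<sigma> l sequentially"
      by blast+
    have "\<forall>k. \<exists>f. f \<in> carrier Adot \<and> \<sigma> k = grad f" using ran by blast
    from choice[OF this] obtain f where "\<forall>k. f k \<in> carrier Adot \<and> \<sigma> k = grad (f k)" by blast
    then have f: "integrable \<mu> (f k)" "grad (f k) \<in> weak_lp_set p (edges Zs)" "\<sigma> k = grad (f k)" for k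
      by (auto simp: carrier_Adot)
    have l: "l \<in> weak_lp_set p (edges Zs)"
      using lim unfolding W.limit_metric_sequentially by simp
    have conv: "\<exists>N. \<forall>k\<ge>N. wnorm (\<lambda>e. grad (f k) e - l e) < \<epsilon>" if \<epsilon>: "\<epsilon> > 0" for \<epsilon>
    proof -
      obtain N where "\<And>k. k \<ge> N \<Longrightarrow> norm_dist W wnorm (\<sigma> k) l < \<epsilon>"
        using lim \<epsilon> unfolding W.limit_metric_sequentially by blast
      then show ?thesis by (auto simp: f(3) norm_dist_weak_lp[OF p_gt_1 f(2) l])
    qed
    define g where "g = (\<lambda>k x. f k x - avg (f k) UNIV)"
    have g: "integrable \<mu> (g k)" for k unfolding g_def by (intro Bochner_Integration.integrable_diff f integrable_const)
    have grad_g: "grad (g k) = grad (f k)" for k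
    proof -
      have "grad (\<lambda>x. avg (f k) UNIV) = (\<lambda>_. 0)" by (rule grad_AE_const) auto
      then show ?thesis unfolding g_def by (simp add: grad_diff[OF f(1)])
    qed
    have UNIV_borel: "UNIV \<in> sets borel" by simp
    have diff: "(LINT x|\<mu>. \<bar>g i x - g j x\<bar>) \<le> poincare_const p * wnorm (\<lambda>e. grad (f i) e - grad (f j) e)" for i j
    proof -
      have eq: "g i x - g j x = (f i x - f j x) - avg (\<lambda>x. f i x - f j x) UNIV" for x
        by (simp add: g_def avg_diff[OF f(1) f(1) UNIV_borel])
      show ?thesis
        unfolding eq using poincare_weak_lp[of "\<lambda>x. f i x - f j x"] f
        by (simp add: grad_diff weak_lp_set_diff[OF p_gt_1])
    qed
    have "\<exists>N. \<forall>i\<ge>N. \<forall>j\<ge>N. (LINT x|\<mu>. \<bar>g i x - g j x\<bar>) < \<epsilon>" if \<epsilon>: "\<epsilon> > 0" for \<epsilon>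
    proof -
      \<comment> \<open>The maximum with 1 makes it safe to divide by \<open>C\<close>.\<close>
      define C where "C = max 1 (poincare_const p)"
      have C: "C > 0" "poincare_const p \<le> C" by (auto simp: C_def)
      obtain N where N: "\<And>k. k \<ge> N \<Longrightarrow> wnorm (\<lambda>e. grad (f k) e - l e) < \<epsilon> / (2 * C)"
        using conv[of "\<epsilon> / (2 * C)"] \<epsilon> C by auto
      have "(LINT x|\<mu>. \<bar>g i x - g j x\<bar>) < \<epsilon>" if "i \<ge> N" "j \<ge> N" for i j
      proof -
        have dist: "norm_dist W wnorm (grad (f i)) (grad (f j))
            \<le> norm_dist W wnorm (grad (f i)) l + norm_dist W wnorm (grad (f j)) l"
          using W.triangle[of "grad (f i)" l "grad (f j)"] W.commute[of l "grad (f j)"] f(2) l by simp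
        then have "wnorm (\<lambda>e. grad (f i) e - grad (f j) e) < \<epsilon> / (2 * C) + \<epsilon> / (2 * C)"
          using N[OF that(1)] N[OF that(2)]
          by (simp add: norm_dist_weak_lp[OF p_gt_1 f(2) f(2)] norm_dist_weak_lp[OF p_gt_1 f(2) l])
        also have "\<dots> = \<epsilon> / C" using C by (simp add: field_simps)
        finally have small: "wnorm (\<lambda>e. grad (f i) e - grad (f j) e) < \<epsilon> / C" .
        have "(LINT x|\<mu>. \<bar>g i x - g j x\<bar>) \<le> C * wnorm (\<lambda>e. grad (f i) e - grad (f j) e)"
          using diff[of i j] C weak_lp_norm_nonneg[OF p_gt_1 weak_lp_set_diff[OF p_gt_1 f(2) f(2)] edges_nonempty]
          by (meson mult_right_mono order_trans)
        also have "\<dots> < C * (\<epsilon> / C)" using small C by (intro mult_strict_left_mono)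
        also have "\<dots> = \<epsilon>" using C by simp
        finally show ?thesis .
      qed
      then show ?thesis by blast
    qed
    from L1_Cauchy_convergent[of \<mu> g, OF g this]
    obtain h where h: "integrable \<mu> h" and gh: "(\<lambda>k. LINT x|\<mu>. \<bar>g k x - h x\<bar>) \<longlonglongrightarrow> 0"
      by blast
    have "grad h = l"
    proof
      fix e
      show "grad h e = l e"
      proof (cases "e \<in> edges Zs")
        case True
        then obtain m n where "snd (ini e) \<in> level_balls Zs m" "snd (ter e) \<in> level_balls Zs n"
          by (rule endpoint_ball)
        then have "(\<lambda>k. grad (g k) e) \<longlonglongrightarrow> grad h e"
          unfolding grad_at[OF True] by (intro tendsto_diff avg_tendsto[OF g h gh])
        moreover have "(\<lambda>k. grad (g k) e) \<longlonglongrightarrow> l e"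
        proof (rule LIMSEQ_I)
          fix \<epsilon> :: real assume "\<epsilon> > 0"
          then obtain N where N: "\<And>k. k \<ge> N \<Longrightarrow> wnorm (\<lambda>e. grad (f k) e - l e) < \<epsilon>"
            using conv by blast
          have "norm (grad (g k) e - l e) < \<epsilon>" if "k \<ge> N" for k
            using abs_le_weak_lp_norm[OF p_gt_1 weak_lp_set_diff[OF p_gt_1 f(2)[of k] l] edges_nonempty, of e]
              N[OF that] by (simp add: grad_g)
          then show "\<exists>N. \<forall>k\<ge>N. norm (grad (g k) e - l e) < \<epsilon>" by blast
        qed
        ultimately show ?thesis by (rule LIMSEQ_unique)
      next
        case False
        then show ?thesis using weak_lp_set_off[OF l False] by (simp add: gradient_def)
      qed
    qed
    then show "l \<in> grad ` carrier Adot" using h l by (auto simp: carrier_Adot)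
  qed
qed

lemma A_space_eq:
  "A_space \<mu> p (edges Zs) ini ter = quotient_module Adot {f \<in> carrier Adot. grad f = \<zero>\<^bsub>W\<^esub>}"
proof -
  have "{f \<in> carrier Adot. \<exists>c. AE x in \<mu>. f x = c} = {f \<in> carrier Adot. grad f = \<zero>\<^bsub>W\<^esub>}"
    by (intro Collect_cong conj_cong refl) (simp add: carrier_Adot grad_eq_0_iff)
  then show ?thesis by (simp add: A_space_def)
qed

lemma A_norm_eq:
  "A_norm \<mu> p (edges Zs) ini ter = (\<lambda>S. wnorm (grad (SOME f. f \<in> S)))"
  by (simp add: A_norm_def fun_eq_iff)

end

theorem proposition1p2:
  fixes \<mu> :: "'z::metric_space measure"
    and Q p :: real
    and Zs :: "nat \<Rightarrow> 'z set"
    and ini ter :: "'z edge \<Rightarrow> 'z vertex"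
  assumes "Q > 0"
    and "compact (UNIV :: 'z set)"
    and "diameter (UNIV :: 'z set) = 1"
    and "ahlfors_regular Q \<mu>"
    and "hyperbolic_filling Zs ini ter"
    and "p > 1"
  shows "(\<forall>S \<in> carrier (A_space \<mu> p (edges Zs) ini ter). \<forall>f \<in> S.
            A_norm \<mu> p (edges Zs) ini ter S
              = weak_lp_norm p (edges Zs) (gradient (edges Zs) ini ter (poisson \<mu> f)))
       \<and> normed_module (A_space \<mu> p (edges Zs) ini ter) (A_norm \<mu> p (edges Zs) ini ter)
       \<and> banach_module (A_space \<mu> p (edges Zs) ini ter) (A_norm \<mu> p (edges Zs) ini ter)
       \<and> (\<exists>W. closed_subspace W (weak_lp p (edges Zs)) (weak_lp_norm p (edges Zs))
            \<and> normed_isomorphic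
                 (A_space \<mu> p (edges Zs) ini ter) (A_norm \<mu> p (edges Zs) ini ter)
                 ((weak_lp p (edges Zs))\<lparr>carrier := W\<rparr>) (weak_lp_norm p (edges Zs)))"
proof -
  have Zs: "\<And>n. n \<ge> 1 \<Longrightarrow> maximal_separated_set (2 powr (- real n)) (Zs n)"
    and orient: "\<And>e. e \<in> edges Zs \<Longrightarrow> e = {ini e, ter e}"
    using assms(5) by (auto simp: hyperbolic_filling_def)
  obtain K where K: "bounded_overlap_covers \<mu> (level_balls Zs) K (2 powr Q)"
    using hyperbolic_filling_bounded_overlap[OF assms(1-4) Zs] by blast
  interpret filling_averages \<mu> Zs K "2 powr Q" ini ter p
    by (intro filling_averages.intro filling_averages_axioms.intro K orient assms(6))
  note iso = isometric_quotient_by_kernel[OF module_Adot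
      banach_module_weak_lp[OF p_gt_1 edges_nonempty] linear_map_grad closedin_range_grad,
      folded A_space_eq A_norm_eq]
  have "normed_module (A_space \<mu> p (edges Zs) ini ter) (A_norm \<mu> p (edges Zs) ini ter)"
    using iso(2) by (rule banach_module.axioms)
  moreover have "\<forall>S \<in> carrier (A_space \<mu> p (edges Zs) ini ter). \<forall>f \<in> S.
      A_norm \<mu> p (edges Zs) ini ter S = wnorm (grad f)"
    unfolding A_norm_eq by (rule iso(1))
  ultimately show ?thesis
    by (intro conjI exI[of _ "grad ` carrier Adot"] iso(2-4))
qed

end
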